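(* Let $\mu$ be a positive finite Borel measure on $[0,1)$ and let $X$ be a Banach space of analytic functions. In each of the following cases, the operator $I_\mu:X\to H(\mathbb{D})$ is well defined and continuous, admits the expression $I_\mu(f)(z)=\sum_{n=0}^\infty\left((A)\text{-}\sum_{k=0}^\infty\mu_{n+k}a_k\right)z^n$ for $f(z)=\sum_{n=0}^\infty a_nz^n\in X$, and $I_\mu(f)=H_\mu(f)$ whenever $\sum_{k=0}^\infty\mu_{n+k}a_k$ converges for each $n\ge0$: (i) $X=H^\infty_v$, where $v$ is a weight on $\mathbb{D}$ with $1/v\in L_1([0,1),\mu)$. If the weight $v$ is essential, then the condition $1/v\in L_1([0,1),\mu)$ is also necessary for $I_\mu:H^\infty_v\to H(\mathbb{D})$ to be well defined. (ii) $X=H^1$ and $\mu$ is a Carleson measure.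
   Context: $\mathbb{D}$ is the open unit disc, $H(\mathbb{D})$ the holomorphic functions on $\mathbb{D}$ with the topology of uniform convergence on compact sets. A Banach space of analytic functions is a Banach space $X\subseteq H(\mathbb{D})$ containing the polynomials with continuous inclusion into $H(\mathbb{D})$. $\mu_n=\int_0^1t^n\,d\mu(t)$; $H_\mu(f)(z)=\sum_n(\sum_k\mu_{n+k}a_k)z^n$ and $I_\mu(f)(z)=\int_0^1\frac{f(t)}{1-tz}\,d\mu(t)$ whenever these define holomorphic functions. A series $\sum a_n$ is Abel summable to $S$, written $S=(A)\text{-}\sum a_n$, if $\sum a_nr^n$ converges for all $0<r<1$ and tends to $S$ as $r\to1^-$. A weight is a function $v:\mathbb{D}\to(0,\infty)$ that is radial, continuous, non-increasing in $|z|$, with $\lim_{r\to1^-}v(r)=0$; $H^\infty_v=\{f\in H(\mathbb{D}):\sup_zv(z)|f(z)|<\infty\}$. $v$ is essential if there is $c>0$ with $c/v(z)\le\sup\{|f(z)|:\sup_\zeta v(\zeta)|f(\zeta)|\le1\}\le1/v(z)$ for all $z$. $H^1$ is the classical Hardy space. $\mu$ is Carleson if $\mu([t,1))=O(1-t)$ as $t\to1^-$. *)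

theory Defs
  imports "HOL-Analysis.Analysis" "HOL-Library.Landau_Symbols"
begin

definition borel_measure_01 :: "real measure \<Rightarrow> bool" where
  "borel_measure_01 \<mu> \<longleftrightarrow> sets \<mu> = sets (restrict_space borel {0..<1}) \<and> finite_measure \<mu>"

definition moment :: "real measure \<Rightarrow> nat \<Rightarrow> real" where
  "moment \<mu> n = (\<integral>t. t ^ n \<partial>\<mu>)"

definition tcoeff :: "(complex \<Rightarrow> complex) \<Rightarrow> nat \<Rightarrow> complex" where
  "tcoeff f n = (deriv ^^ n) f 0 / of_nat (fact n)"

definition Imu :: "real measure \<Rightarrow> (complex \<Rightarrow> complex) \<Rightarrow> complex \<Rightarrow> complex" where
  "Imu \<mu> f z = (\<integral>t. f (complex_of_real t) / (1 - complex_of_real t * z) \<partial>\<mu>)"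

definition abel_sums :: "(nat \<Rightarrow> complex) \<Rightarrow> complex \<Rightarrow> bool" where
  "abel_sums a S \<longleftrightarrow>
     (\<forall>r::real. 0 < r \<and> r < 1 \<longrightarrow> summable (\<lambda>n. a n * of_real r ^ n)) \<and>
     ((\<lambda>r::real. \<Sum>n. a n * of_real r ^ n) \<longlongrightarrow> S) (at_left 1)"

definition Imu_well_defined :: "real measure \<Rightarrow> (complex \<Rightarrow> complex) set \<Rightarrow> bool" where
  "Imu_well_defined \<mu> X \<longleftrightarrow>
     (\<forall>f\<in>X. (\<forall>z\<in>ball 0 1. integrable \<mu> (\<lambda>t. f (complex_of_real t) / (1 - complex_of_real t * z)))
             \<and> Imu \<mu> f holomorphic_on ball 0 1)"

text \<open>Continuity of I_mu : (X, nrm) -> H(D), H(D) carrying the topology of uniform convergence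
  on compact subsets of the disc (sequential continuity; X is a normed, hence metric, space).\<close>
definition Imu_continuous ::
    "real measure \<Rightarrow> (complex \<Rightarrow> complex) set \<Rightarrow> ((complex \<Rightarrow> complex) \<Rightarrow> real) \<Rightarrow> bool" where
  "Imu_continuous \<mu> X nrm \<longleftrightarrow>
     (\<forall>g f. (\<forall>n. g n \<in> X) \<longrightarrow> f \<in> X \<longrightarrow> (\<lambda>n. nrm (\<lambda>z. g n z - f z)) \<longlonglongrightarrow> 0 \<longrightarrow>
        (\<forall>K. compact K \<and> K \<subseteq> ball 0 1 \<longrightarrow>
             uniform_limit K (\<lambda>n. Imu \<mu> (g n)) (Imu \<mu> f) sequentially))"

definition Imu_good ::
    "real measure \<Rightarrow> (complex \<Rightarrow> complex) set \<Rightarrow> ((complex \<Rightarrow> complex) \<Rightarrow> real) \<Rightarrow> bool" where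
  "Imu_good \<mu> X nrm \<longleftrightarrow>
     Imu_well_defined \<mu> X \<and> Imu_continuous \<mu> X nrm \<and>
     (\<forall>f\<in>X. \<exists>A. (\<forall>n. abel_sums (\<lambda>k. of_real (moment \<mu> (n + k)) * tcoeff f k) (A n)) \<and>
                 (\<forall>z\<in>ball 0 1. (\<lambda>n. A n * z ^ n) sums Imu \<mu> f z)) \<and>
     (\<forall>f\<in>X. (\<forall>n. summable (\<lambda>k. of_real (moment \<mu> (n + k)) * tcoeff f k)) \<longrightarrow>
        (\<forall>z\<in>ball 0 1.
           (\<lambda>n. (\<Sum>k. of_real (moment \<mu> (n + k)) * tcoeff f k) * z ^ n) sums Imu \<mu> f z))"

definition weight :: "(complex \<Rightarrow> real) \<Rightarrow> bool" where
  "weight v \<longleftrightarrow>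
     (\<forall>z\<in>ball 0 1. v z > 0) \<and>
     (\<forall>z\<in>ball 0 1. v z = v (complex_of_real (norm z))) \<and>
     continuous_on (ball 0 1) v \<and>
     (\<forall>z\<in>ball 0 1. \<forall>w\<in>ball 0 1. norm z \<le> norm w \<longrightarrow> v w \<le> v z) \<and>
     ((\<lambda>r::real. v (complex_of_real r)) \<longlongrightarrow> 0) (at_left 1)"

definition Hinf_v :: "(complex \<Rightarrow> real) \<Rightarrow> (complex \<Rightarrow> complex) set" where
  "Hinf_v v = {f. f holomorphic_on ball 0 1 \<and> bdd_above ((\<lambda>z. v z * norm (f z)) ` ball 0 1)}"

definition Hinf_v_norm :: "(complex \<Rightarrow> real) \<Rightarrow> (complex \<Rightarrow> complex) \<Rightarrow> real" where
  "Hinf_v_norm v f = (SUP z\<in>ball 0 1. v z * norm (f z))"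

definition essential_weight :: "(complex \<Rightarrow> real) \<Rightarrow> bool" where
  "essential_weight v \<longleftrightarrow>
     (\<exists>c>0. \<forall>z\<in>ball 0 1.
        c / v z \<le> (SUP f\<in>{f\<in>Hinf_v v. Hinf_v_norm v f \<le> 1}. norm (f z)) \<and>
        (SUP f\<in>{f\<in>Hinf_v v. Hinf_v_norm v f \<le> 1}. norm (f z)) \<le> 1 / v z)"

definition H1_mean :: "(complex \<Rightarrow> complex) \<Rightarrow> real \<Rightarrow> real" where
  "H1_mean f r = (1 / (2 * pi)) * (LINT t:{0..2*pi}|lborel. norm (f (of_real r * cis t)))"

definition H1 :: "(complex \<Rightarrow> complex) set" where
  "H1 = {f. f holomorphic_on ball 0 1 \<and> bdd_above (H1_mean f ` {0<..<1})}"

definition H1_norm :: "(complex \<Rightarrow> complex) \<Rightarrow> real" where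
  "H1_norm f = (SUP r\<in>{0<..<1}. H1_mean f r)"

definition carleson :: "real measure \<Rightarrow> bool" where
  "carleson \<mu> \<longleftrightarrow> (\<lambda>t. measure \<mu> {t..<1}) \<in> O[at_left 1](\<lambda>t. 1 - t)"

end

theory Submission
  imports Defs "HOL-Complex_Analysis.Complex_Analysis"
    "HOL-Computational_Algebra.Fundamental_Theorem_Algebra"
begin

text \<open>
  Everything positive follows from a radial domination: if \<open>\<bar>f(rt)\<bar> \<le> g(t)\<close> for all \<open>0 \<le> r \<le> 1\<close> with
  \<open>g\<close> integrable, then \<open>I\<^sub>\<mu> f\<close> has the Taylor coefficients \<open>\<integral> t\<^sup>n f(t) d\<mu>\<close>, the Abel means of
  \<open>\<Sum>\<^sub>k \<mu>\<^sub>n\<^sub>+\<^sub>k a\<^sub>k\<close> are \<open>\<integral> t\<^sup>n f(rt) d\<mu>\<close>, and dominated convergence lets \<open>r \<rightarrow> 1\<close>. For \<open>H\<^sup>\<infinity>\<^sub>v\<close> the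
  function \<open>g = \<parallel>f\<parallel>/v\<close> serves.

  For \<open>H\<^sup>1\<close>, a polynomial \<open>p\<close> is dominated in the disc by a zero-free polynomial \<open>q\<close> with
  \<open>\<bar>q\<bar> = \<bar>p\<bar>\<close> on the circle (reflect the roots), and \<open>q = (\<Sum> b\<^sub>n z\<^sup>n)\<^sup>2\<close> there. Hence
  \<open>\<bar>p(s)\<bar> \<le> (\<Sum> \<bar>b\<^sub>n\<bar> t\<^sup>n)\<^sup>2\<close> for all \<open>s \<le> t\<close>. Since \<open>\<mu>\<^sub>n = O(1/n)\<close>, Hilbert's inequality bounds
  the \<open>\<mu>\<close>-integral of the right-hand side by \<open>\<Sum> \<bar>b\<^sub>n\<bar>\<^sup>2\<close>, which is the mean of \<open>\<bar>p\<bar>\<close> on the circle.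
  Fatou's lemma extends this to \<open>H\<^sup>1\<close>.

  For the necessity, the monomials \<open>A\<^sub>n t\<^sup>n\<close> touching \<open>1/v\<close> from below control the unit ball of
  \<open>H\<^sup>\<infinity>\<^sub>v\<close> by the maximum principle on annuli. A greedy choice of exponents thins them out to two lacunary
  series in \<open>H\<^sup>\<infinity>\<^sub>v\<close> whose sum still dominates all the monomials, hence \<open>1/v\<close> on the radius
  when \<open>v\<close> is essential.
\<close>

section \<open>Radial domination\<close>

text \<open>Summation by parts: with \<open>s n\<close> the partial sums minus \<open>S\<close>, the
  Abel mean equals \<open>S\<close> plus \<open>1 - r\<close> times the sum of
  \<open>s n * r ^ n\<close>. The first \<open>N\<close> terms are killed by the factor
  \<open>1 - r\<close>, and the tail, where \<open>s n\<close> is below \<open>e / 2\<close>,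
  contributes at most \<open>e / 2\<close>. This is what identifies Abel sums with ordinary sums
  when the latter exist.\<close>

lemma Abel_limit:
  fixes a :: "nat \<Rightarrow> complex"
  assumes "a sums S"
  shows "((\<lambda>r::real. \<Sum>n. a n * of_real r ^ n) \<longlongrightarrow> S) (at_left 1)"
proof -
  define s where "s n = (\<Sum>k\<le>n. a k) - S" for n
  have s0: "s \<longlonglongrightarrow> 0"
    using assms unfolding sums_def_le s_def using LIM_zero by blast
  have "Bseq s" using s0 convergent_def convergent_imp_Bseq by blast
  then obtain B where B: "B > 0" "\<And>n. norm (s n) \<le> B" unfolding Bseq_def by blast
  have geo: "summable (\<lambda>n. norm (s n) * r ^ n)" if "0 < r" "r < 1" for r :: real
    by (rule summable_comparison_test'[where g = "\<lambda>n. B * r ^ n" and N = 0])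
       (use that B in \<open>auto intro!: summable_mult summable_geometric mult_right_mono\<close>)
  have eq: "(\<lambda>n. a n * of_real r ^ n) sums (S + (1 - of_real r) * (\<Sum>n. s n * of_real r ^ n))"
    if r: "0 < r" "r < 1" for r :: real
  proof -
    have "summable (\<lambda>n. norm (s n * of_real r ^ n))"
      using geo[OF r] r by (simp add: norm_mult norm_power)
    then have sm: "(\<lambda>n. s n * of_real r ^ n) sums (\<Sum>n. s n * of_real r ^ n)" (is "_ sums ?T")
      by (rule summable_sums[OF summable_norm_cancel])
    \<comment> \<open>The sequence \<open>s\<close> shifted by one place. The value
      \<open>- S\<close> at \<open>n = 0\<close> belongs to the empty partial sum, so that
      consecutive differences give \<open>a n\<close> for \<open>n = 0\<close> as well.\<close>
    have "(\<lambda>n. (if n = 0 then - S else s (n - 1)) * of_real r ^ n) sums (of_real r * ?T + (- S))"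
    proof -
      have "(\<lambda>n. s n * of_real r ^ Suc n) sums (of_real r * ?T)"
        using sums_mult[OF sm, of "of_real r"] by (simp add: mult_ac)
      then show ?thesis
        using sums_Suc[of "\<lambda>n. (if n = 0 then - S else s (n - 1)) * of_real r ^ n"] by simp
    qed
    from sums_diff[OF sm this]
    have "(\<lambda>n. s n * of_real r ^ n - (if n = 0 then - S else s (n - 1)) * of_real r ^ n) sums (?T - (of_real r * ?T + (- S)))" .
    moreover have "s n * of_real r ^ n - (if n = 0 then - S else s (n - 1)) * of_real r ^ n = a n * of_real r ^ n" for n
      by (cases n) (auto simp: s_def algebra_simps)
    ultimately show ?thesis by (simp add: algebra_simps)
  qed
  have bd: "\<forall>\<^sub>F r in at_left (1::real). norm ((\<Sum>n. a n * of_real r ^ n) - S) < e" if "e > 0" for e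
  proof -
    obtain N where N: "\<And>n. n \<ge> N \<Longrightarrow> norm (s n) < e / 2"
      using s0 \<open>e > 0\<close> unfolding LIMSEQ_iff by (metis diff_zero half_gt_zero)
    have ev: "\<forall>\<^sub>F r in at_left (1::real). (1 - r) * (\<Sum>n<N. norm (s n)) < e / 2"
    proof (rule order_tendstoD(2))
      show "((\<lambda>r. (1 - r) * (\<Sum>n<N. norm (s n))) \<longlongrightarrow> (1 - 1) * (\<Sum>n<N. norm (s n))) (at_left (1::real))"
        by (intro tendsto_intros)
    qed (use \<open>e > 0\<close> in simp)
    have ev2: "\<forall>\<^sub>F r in at_left (1::real). 0 < r \<and> r < 1"
      by (auto simp: eventually_at_left_field intro!: exI[of _ 0])
    show ?thesis using ev ev2
    proof eventually_elim
      case (elim r)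
      then have r: "0 < r" "r < 1" by auto
      have "(\<Sum>n. a n * of_real r ^ n) - S = (1 - of_real r) * (\<Sum>n. s n * of_real r ^ n)"
        using eq[OF r] by (simp add: sums_iff)
      then have "norm ((\<Sum>n. a n * of_real r ^ n) - S) = (1 - r) * norm (\<Sum>n. s n * of_real r ^ n)"
        using r norm_of_real[of "1 - r", where ?'a = complex] by (simp add: norm_mult)
      also have "norm (\<Sum>n. s n * of_real r ^ n) \<le> (\<Sum>n. norm (s n) * r ^ n)"
        using summable_norm[of "\<lambda>n. s n * of_real r ^ n"] geo[OF r] r by (simp add: norm_mult norm_power)
      also have "(\<Sum>n. norm (s n) * r ^ n) = (\<Sum>n. norm (s (n + N)) * r ^ (n + N)) + (\<Sum>n<N. norm (s n) * r ^ n)"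
        by (rule suminf_split_initial_segment[OF geo[OF r]])
      also have "(\<Sum>n<N. norm (s n) * r ^ n) \<le> (\<Sum>n<N. norm (s n))"
        by (intro sum_mono) (use r in \<open>simp add: mult_left_le power_le_one\<close>)
      also have "(\<Sum>n. norm (s (n + N)) * r ^ (n + N)) \<le> (\<Sum>n. e / 2 * r ^ n)"
      proof (rule suminf_le)
        show "norm (s (n + N)) * r ^ (n + N) \<le> e / 2 * r ^ n" for n
          using N[of "n + N"] r \<open>e > 0\<close> by (intro mult_mono power_decreasing) auto
        show "summable (\<lambda>n. norm (s (n + N)) * r ^ (n + N))"
          using geo[OF r] summable_iff_shift[of "\<lambda>n. norm (s n) * r ^ n" N] by blast
      qed (use r in \<open>auto intro!: summable_mult summable_geometric\<close>)
      also have "\<dots> = e / 2 * (1 / (1 - r))"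
        using r by (subst suminf_mult) (auto simp: suminf_geometric summable_geometric)
      finally have "norm ((\<Sum>n. a n * of_real r ^ n) - S) \<le> (1 - r) * (e / 2 * (1 / (1 - r)) + (\<Sum>n<N. norm (s n)))"
        using r by (simp add: mult_left_mono)
      also have "\<dots> = e / 2 + (1 - r) * (\<Sum>n<N. norm (s n))"
        using r by (simp add: field_simps)
      finally show ?case using elim by linarith
    qed
  qed
  show ?thesis
    using bd by (auto simp: tendsto_iff dist_norm)
qed

section \<open>Measures on [0,1), Taylor series and the weighted space\<close>

lemma space_borel_measure_01: "borel_measure_01 \<mu> \<Longrightarrow> space \<mu> = {0..<1}"
  unfolding borel_measure_01_def by (metis inf_top_right sets_eq_imp_space_eq space_borel space_restrict_space)

lemma borel_measurable_01_continuous: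
  fixes f :: "real \<Rightarrow> 'b :: topological_space"
  assumes "borel_measure_01 \<mu>" "continuous_on {0..<1} f"
  shows "f \<in> borel_measurable \<mu>"
proof -
  have "f \<in> borel_measurable (restrict_space borel {0..<1})"
    using assms(2) borel_measurable_continuous_on_restrict by blast
  then show ?thesis
    using assms(1) measurable_cong_sets unfolding borel_measure_01_def by blast
qed

lemma continuous_on_radial:
  assumes "f holomorphic_on ball 0 1" "0 \<le> r" "r \<le> 1"
  shows "continuous_on {0..<1} (\<lambda>t. f (complex_of_real (r * t)))"
proof -
  have "continuous_on (ball 0 1) f" using assms holomorphic_on_imp_continuous_on by blast
  moreover have "(\<lambda>t. complex_of_real (r * t)) ` {0..<1} \<subseteq> ball 0 1"
  proof safe
    fix t :: real assume t: "t \<in> {0..<1}"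
    then have "r * t \<le> 1 * t" using assms by (intro mult_right_mono) auto
    then show "complex_of_real (r * t) \<in> ball 0 1" using assms t by (simp add: norm_mult)
  qed
  ultimately show ?thesis
    by (rule_tac continuous_on_compose2[of "ball 0 1" f]) (auto intro!: continuous_intros)
qed

lemma tcoeff_sums:
  assumes "f holomorphic_on ball 0 1" "norm z < 1"
  shows "(\<lambda>k. tcoeff f k * z ^ k) sums f z"
  using holomorphic_power_series[OF assms(1), of z] assms(2) by (simp add: tcoeff_def)

lemma tcoeff_abs_summable:
  assumes "f holomorphic_on ball 0 1" "0 \<le> r" "r < 1"
  shows "summable (\<lambda>k. norm (tcoeff f k) * r ^ k)"
proof -
  \<comment> \<open>The midpoint of \<open>r\<close> and 1 is still inside the disc and strictly
    larger than \<open>r\<close>, so convergence there forces absolute convergence at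
    \<open>r\<close>.\<close>
  have "summable (\<lambda>k. tcoeff f k * of_real ((1 + r) / 2) ^ k)"
    using tcoeff_sums[OF assms(1), of "of_real ((1 + r) / 2)"] assms by (auto simp: sums_iff simp del: of_real_divide of_real_add)
  from powser_insidea[OF this, of "of_real r"]
  show ?thesis using assms by (simp add: norm_mult norm_power del: of_real_divide of_real_add)
qed

lemma weight_pos: "weight v \<Longrightarrow> z \<in> ball 0 1 \<Longrightarrow> 0 < v z"
  unfolding weight_def by blast

lemma Hinf_v_bound:
  assumes "f \<in> Hinf_v v" "z \<in> ball 0 1"
  shows "v z * norm (f z) \<le> Hinf_v_norm v f"
  unfolding Hinf_v_norm_def
  by (rule cSUP_upper[where f = "\<lambda>z. v z * norm (f z)"]) (use assms in \<open>simp_all add: Hinf_v_def\<close>)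

lemma Hinf_v_diff:
  assumes v: "weight v" and f: "f \<in> Hinf_v v" and h: "h \<in> Hinf_v v"
  shows "(\<lambda>z. f z - h z) \<in> Hinf_v v"
proof -
  have "v z * norm (f z - h z) \<le> Hinf_v_norm v f + Hinf_v_norm v h" if z: "z \<in> ball 0 1" for z
  proof -
    have "v z \<ge> 0" using weight_pos[OF v z] by simp
    then have "v z * norm (f z - h z) \<le> v z * norm (f z) + v z * norm (h z)"
      unfolding distrib_left[symmetric] by (intro mult_left_mono norm_triangle_ineq4)
    then show ?thesis using Hinf_v_bound[OF f z] Hinf_v_bound[OF h z] by linarith
  qed
  then show ?thesis
    using f h unfolding Hinf_v_def by (auto intro!: bdd_aboveI2 holomorphic_intros)
qed

section \<open>Power series, Abel means and continuity under a radial majorant\<close>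

text \<open>The quantifier over \<open>r\<close> stands inside the almost-everywhere statement:
  \<open>g t\<close> bounds \<open>f\<close> on the whole segment from 0 to \<open>t\<close>, and
  one null set serves all dilations. An exceptional null set is allowed because the majorant built
  for \<open>H1\<close> may be infinite on one.\<close>

definition radially_dominated :: "real measure \<Rightarrow> (complex \<Rightarrow> complex) \<Rightarrow> (real \<Rightarrow> real) \<Rightarrow> bool" where
  "radially_dominated \<mu> f g \<longleftrightarrow> f holomorphic_on ball 0 1 \<and> integrable \<mu> g \<and>
     (AE t in \<mu>. \<forall>r\<in>{0..1}. norm (f (complex_of_real (r * t))) \<le> g t)"

context
  fixes \<mu> :: "real measure"
  assumes \<mu>: "borel_measure_01 \<mu>"
begin

text \<open>The bounded factor \<open>h\<close> is left free so that the Cauchy kernel and the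
  powers of \<open>t\<close> are both instances.\<close>

lemma radially_dominated_integrable:
  assumes D: "radially_dominated \<mu> f g" and r: "r \<in> {0..1}"
    and h: "continuous_on {0..<1} h" "\<And>t. t \<in> {0..<1} \<Longrightarrow> norm (h t) \<le> B"
  shows "integrable \<mu> (\<lambda>t. h t * f (complex_of_real (r * t)))"
proof (rule Bochner_Integration.integrable_bound[where f = "\<lambda>t. B * g t"])
  show "integrable \<mu> (\<lambda>t. B * g t)" using D unfolding radially_dominated_def by auto
  show "(\<lambda>t. h t * f (complex_of_real (r * t))) \<in> borel_measurable \<mu>"
    using D r h continuous_on_radial[of f r] unfolding radially_dominated_def
    by (intro borel_measurable_01_continuous[OF \<mu>] continuous_on_mult) auto
  have "AE t in \<mu>. \<forall>r\<in>{0..1}. norm (f (complex_of_real (r * t))) \<le> g t"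
    using D unfolding radially_dominated_def by auto
  then show "AE t in \<mu>. norm (h t * f (complex_of_real (r * t))) \<le> norm (B * g t)"
    using AE_space
  proof eventually_elim
    case (elim t)
    then have "norm (f (complex_of_real (r * t))) \<le> g t" "norm (h t) \<le> B"
      using r h(2) space_borel_measure_01[OF \<mu>] by auto
    then have "norm (h t * f (complex_of_real (r * t))) \<le> B * g t"
      unfolding norm_mult by (intro mult_mono) (auto intro: order_trans[OF norm_ge_zero])
    then show ?case by simp
  qed
qed

lemma finite_measure_mu: "finite_measure \<mu>"
  using \<mu> unfolding borel_measure_01_def by auto

lemma Imu_kernel_integrable:
  assumes D: "radially_dominated \<mu> f g" and z: "norm z < 1"
  shows "integrable \<mu> (\<lambda>t. f (complex_of_real t) / (1 - complex_of_real t * z))"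
proof -
  have b: "1 - norm z \<le> norm (1 - complex_of_real t * z)" if t: "t \<in> {0..<1}" for t
  proof -
    have "norm (of_real t * z) \<le> 1 * norm z" using t unfolding norm_mult by (intro mult_right_mono) auto
    then show ?thesis using norm_triangle_ineq2[of 1 "of_real t * z"] by simp
  qed
  then have nz: "1 - complex_of_real t * z \<noteq> 0" if "t \<in> {0..<1}" for t
    using z that by fastforce
  have "integrable \<mu> (\<lambda>t. inverse (1 - complex_of_real t * z) * f (complex_of_real (1 * t)))"
    using z b nz
    by (intro radially_dominated_integrable[OF D, where B = "inverse (1 - norm z)"])
       (auto intro!: continuous_intros simp: norm_inverse le_imp_inverse_le)
  then show ?thesis by (simp add: field_simps)
qed

text \<open>The kernel is expanded into its geometric series. Integrating term by term is legitimate
  because the \<open>n\<close>-th term has norm integral at most \<open>norm z ^ n\<close> times the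
  integral of the modulus of \<open>f\<close> on the radius.\<close>

lemma Imu_sums:
  assumes D: "radially_dominated \<mu> f g" and z: "norm z < 1"
  shows "(\<lambda>n. (\<integral>t. of_real t ^ n * f (of_real t) \<partial>\<mu>) * z ^ n) sums Imu \<mu> f z"
proof -
  have If: "integrable \<mu> (\<lambda>t. norm (f (complex_of_real t)))"
    using radially_dominated_integrable[OF D, of 1 "\<lambda>_. 1" 1] by (auto intro: integrable_norm)
  have It: "integrable \<mu> (\<lambda>t. of_real t ^ n * f (of_real t))" for n
  proof -
    have "continuous_on {0..<1} (\<lambda>t. complex_of_real t ^ n)" by (intro continuous_intros)
    from radially_dominated_integrable[OF D, of 1, OF _ this, of 1] show ?thesis
      by (simp add: norm_power power_le_one)
  qed
  have le: "norm (of_real t ^ n * f (of_real t) * z ^ n) \<le> norm (f (of_real t)) * norm z ^ n"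
    if "t \<in> space \<mu>" for t n
    using that space_borel_measure_01[OF \<mu>]
    by (auto simp: norm_mult norm_power intro!: mult_right_mono mult_left_le_one_le power_le_one)
  have "(\<lambda>n. \<integral>t. of_real t ^ n * f (of_real t) * z ^ n \<partial>\<mu>) sums
        (\<integral>t. (\<Sum>n. of_real t ^ n * f (of_real t) * z ^ n) \<partial>\<mu>)"
  proof (rule sums_integral)
    show "integrable \<mu> (\<lambda>t. of_real t ^ n * f (of_real t) * z ^ n)" for n using It by auto
    show "AE t in \<mu>. summable (\<lambda>n. norm (of_real t ^ n * f (of_real t) * z ^ n))"
    proof (rule AE_I2)
      fix t assume "t \<in> space \<mu>"
      then show "summable (\<lambda>n. norm (of_real t ^ n * f (of_real t) * z ^ n))"
        by (rule_tac summable_comparison_test'[where g = "\<lambda>n. norm (f (of_real t)) * norm z ^ n" and N = 0])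
           (use le z in \<open>auto intro!: summable_mult summable_geometric\<close>)
    qed
    show "summable (\<lambda>n. \<integral>t. norm (of_real t ^ n * f (of_real t) * z ^ n) \<partial>\<mu>)"
    proof (rule summable_comparison_test'[where g = "\<lambda>n. (\<integral>t. norm (f (of_real t)) \<partial>\<mu>) * norm z ^ n"])
      fix n
      have "(\<integral>t. norm (of_real t ^ n * f (of_real t) * z ^ n) \<partial>\<mu>) \<le> (\<integral>t. norm (f (of_real t)) * norm z ^ n \<partial>\<mu>)"
        using It If le by (intro integral_mono) (auto intro!: integrable_norm)
      then show "norm (\<integral>t. norm (of_real t ^ n * f (of_real t) * z ^ n) \<partial>\<mu>) \<le> (\<integral>t. norm (f (of_real t)) \<partial>\<mu>) * norm z ^ n"
        by (simp add: integral_nonneg_AE)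
    qed (use z in \<open>auto intro!: summable_mult summable_geometric\<close>)
  qed
  moreover have "(\<integral>t. (\<Sum>n. of_real t ^ n * f (of_real t) * z ^ n) \<partial>\<mu>) = Imu \<mu> f z"
    unfolding Imu_def
  proof (rule Bochner_Integration.integral_cong[OF refl])
    fix t assume t: "t \<in> space \<mu>"
    have "norm (of_real t * z) < 1"
      using t space_borel_measure_01[OF \<mu>] z mult_left_le_one_le[of "norm z" t] by (auto simp: norm_mult)
    from sums_mult[OF geometric_sums[OF this], of "f (of_real t)"]
    show "(\<Sum>n. of_real t ^ n * f (of_real t) * z ^ n) = f (of_real t) / (1 - of_real t * z)"
      by (simp add: sums_iff power_mult_distrib mult_ac)
  qed
  ultimately show ?thesis by simp
qed

text \<open>For \<open>r < 1\<close> the Taylor series of \<open>f\<close> at \<open>r * t\<close>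
  is dominated by the summable series of \<open>norm (tcoeff f k) * r ^ k\<close>, uniformly in
  \<open>t\<close>, and \<open>\<mu>\<close> is finite; hence it may be integrated term by term.
  Abel means thus become integrals of dilations of \<open>f\<close>.\<close>

lemma moment_tcoeff_sums:
  assumes D: "radially_dominated \<mu> f g" and r: "0 < r" "r < 1"
  shows "(\<lambda>k. of_real (moment \<mu> (n + k)) * tcoeff f k * of_real r ^ k) sums
           (\<integral>t. of_real t ^ n * f (of_real (r * t)) \<partial>\<mu>)"
proof -
  interpret finite_measure \<mu> by (rule finite_measure_mu)
  have hol: "f holomorphic_on ball 0 1" using D unfolding radially_dominated_def by auto
  note S = space_borel_measure_01[OF \<mu>]
  have It: "integrable \<mu> (\<lambda>t. t ^ m :: real)" for m
    by (rule Bochner_Integration.integrable_bound[of _ "\<lambda>_. 1::real"])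
       (auto intro!: borel_measurable_01_continuous[OF \<mu>] continuous_intros AE_I2 simp: S power_le_one)
  have Ic: "integrable \<mu> (\<lambda>t. complex_of_real t ^ m)" for m
    using integrable_of_real[OF It[of m]] by simp
  have le: "norm (complex_of_real t ^ (n + k) * tcoeff f k * of_real r ^ k) \<le> norm (tcoeff f k) * r ^ k"
    if "t \<in> space \<mu>" for t k
    using that r S by (auto simp: norm_mult norm_power intro!: mult_right_mono mult_left_le_one_le power_le_one)
  have "(\<lambda>k. \<integral>t. complex_of_real t ^ (n + k) * tcoeff f k * of_real r ^ k \<partial>\<mu>) sums
        (\<integral>t. (\<Sum>k. complex_of_real t ^ (n + k) * tcoeff f k * of_real r ^ k) \<partial>\<mu>)"
  proof (rule sums_integral)
    show I: "integrable \<mu> (\<lambda>t. complex_of_real t ^ (n + k) * tcoeff f k * of_real r ^ k)" for k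
      using Ic by auto
    show "AE t in \<mu>. summable (\<lambda>k. norm (complex_of_real t ^ (n + k) * tcoeff f k * of_real r ^ k))"
    proof (rule AE_I2)
      fix t assume "t \<in> space \<mu>"
      then show "summable (\<lambda>k. norm (complex_of_real t ^ (n + k) * tcoeff f k * of_real r ^ k))"
        by (rule_tac summable_comparison_test'[OF tcoeff_abs_summable[OF hol, of r], where N = 0])
           (use le r in auto)
    qed
    show "summable (\<lambda>k. \<integral>t. norm (complex_of_real t ^ (n + k) * tcoeff f k * of_real r ^ k) \<partial>\<mu>)"
    proof (rule summable_comparison_test'[where g = "\<lambda>k. measure \<mu> (space \<mu>) * (norm (tcoeff f k) * r ^ k)"])
      fix k
      have "(\<integral>t. norm (complex_of_real t ^ (n + k) * tcoeff f k * of_real r ^ k) \<partial>\<mu>) \<le> (\<integral>t. norm (tcoeff f k) * r ^ k \<partial>\<mu>)"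
        using I le by (intro integral_mono) (auto intro!: integrable_norm)
      then show "norm (\<integral>t. norm (complex_of_real t ^ (n + k) * tcoeff f k * of_real r ^ k) \<partial>\<mu>) \<le> measure \<mu> (space \<mu>) * (norm (tcoeff f k) * r ^ k)"
        by (simp add: integral_nonneg_AE)
    qed (use r tcoeff_abs_summable[OF hol, of r] in \<open>auto intro!: summable_mult\<close>)
  qed
  moreover have "(\<integral>t. (\<Sum>k. complex_of_real t ^ (n + k) * tcoeff f k * of_real r ^ k) \<partial>\<mu>) = (\<integral>t. of_real t ^ n * f (of_real (r * t)) \<partial>\<mu>)"
  proof (rule Bochner_Integration.integral_cong[OF refl])
    fix t assume t: "t \<in> space \<mu>"
    have "norm (complex_of_real (r * t)) < 1"
      using t S r mult_left_le_one_le[of t r] by (auto simp: norm_mult)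
    from sums_mult[OF tcoeff_sums[OF hol this], of "of_real t ^ n"]
    show "(\<Sum>k. complex_of_real t ^ (n + k) * tcoeff f k * of_real r ^ k) = of_real t ^ n * f (of_real (r * t))"
      by (simp add: sums_iff power_mult_distrib power_add mult_ac)
  qed
  moreover have "(\<integral>t. complex_of_real t ^ (n + k) * tcoeff f k * of_real r ^ k \<partial>\<mu>) = of_real (moment \<mu> (n + k)) * tcoeff f k * of_real r ^ k" for k
  proof -
    have "(\<integral>t. complex_of_real t ^ (n + k) \<partial>\<mu>) = of_real (moment \<mu> (n + k))"
      unfolding moment_def by (simp flip: of_real_power)
    then show ?thesis using Ic by simp
  qed
  ultimately show ?thesis by (simp only:)
qed

text \<open>The Abel means are the integrals of \<open>t ^ n\<close> times dilations of
  \<open>f\<close>; all of these are dominated by \<open>g\<close>, so dominated convergence gives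
  the limit.\<close>

lemma abel_sums_moment_tcoeff:
  assumes D: "radially_dominated \<mu> f g"
  shows "abel_sums (\<lambda>k. of_real (moment \<mu> (n + k)) * tcoeff f k) (\<integral>t. of_real t ^ n * f (of_real t) \<partial>\<mu>)"
  unfolding abel_sums_def
proof (intro conjI allI impI)
  fix r :: real assume "0 < r \<and> r < 1"
  then show "summable (\<lambda>k. of_real (moment \<mu> (n + k)) * tcoeff f k * of_real r ^ k)"
    using moment_tcoeff_sums[OF D] sums_summable by blast
next
  note S = space_borel_measure_01[OF \<mu>]
  have hol: "f holomorphic_on ball 0 1" and g: "integrable \<mu> g"
    and dom: "AE t in \<mu>. \<forall>r\<in>{0..1}. norm (f (complex_of_real (r * t))) \<le> g t"
    using D unfolding radially_dominated_def by auto
  show "((\<lambda>r. \<Sum>k. of_real (moment \<mu> (n + k)) * tcoeff f k * of_real r ^ k) \<longlongrightarrow> (\<integral>t. of_real t ^ n * f (of_real t) \<partial>\<mu>)) (at_left 1)"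
  \<comment> \<open>Dominated convergence works along sequences, so the one-sided limit is tested on
    sequences in (0,1), where the formula for the Abel means holds.\<close>
  proof (rule tendsto_at_left_sequentially[of 0])
    fix R :: "nat \<Rightarrow> real" assume R: "\<And>i. R i < 1" "\<And>i. 0 < R i" "R \<longlonglongrightarrow> 1"
    have eq: "(\<Sum>k. of_real (moment \<mu> (n + k)) * tcoeff f k * of_real (R i) ^ k) = (\<integral>t. of_real t ^ n * f (of_real (R i * t)) \<partial>\<mu>)" for i
      using moment_tcoeff_sums[OF D R(2,1)] by (simp add: sums_iff)
    show "(\<lambda>i. \<Sum>k. of_real (moment \<mu> (n + k)) * tcoeff f k * of_real (R i) ^ k) \<longlonglongrightarrow> (\<integral>t. of_real t ^ n * f (of_real t) \<partial>\<mu>)"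
      unfolding eq
    proof (rule integral_dominated_convergence[where w = g])
      show "(\<lambda>t. of_real t ^ n * f (of_real t)) \<in> borel_measurable \<mu>"
        using continuous_on_radial[OF hol, of 1] by (auto intro!: borel_measurable_01_continuous[OF \<mu>] continuous_intros)
      show "(\<lambda>t. of_real t ^ n * f (of_real (R i * t))) \<in> borel_measurable \<mu>" for i
        using continuous_on_radial[OF hol, of "R i"] R(1,2)[of i] by (intro borel_measurable_01_continuous[OF \<mu>] continuous_intros) auto
      show "AE t in \<mu>. (\<lambda>i. of_real t ^ n * f (of_real (R i * t))) \<longlonglongrightarrow> of_real t ^ n * f (of_real t)"
      proof (rule AE_I2)
        fix t assume t: "t \<in> space \<mu>"
        have "isCont f (of_real t)"
          using hol t S by (auto intro!: continuous_on_interior holomorphic_on_imp_continuous_on simp: interior_open)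
        moreover have "(\<lambda>i. complex_of_real (R i * t)) \<longlonglongrightarrow> of_real (1 * t)"
          by (intro tendsto_intros R)
        ultimately show "(\<lambda>i. of_real t ^ n * f (of_real (R i * t))) \<longlonglongrightarrow> of_real t ^ n * f (of_real t)"
          by (intro tendsto_mult tendsto_const isCont_tendsto_compose[of "of_real t" f]) simp_all
      qed
      show "AE t in \<mu>. norm (of_real t ^ n * f (of_real (R i * t))) \<le> g t" for i
        using dom AE_space
      proof eventually_elim
        case (elim t)
        have "norm (of_real t ^ n * f (of_real (R i * t))) \<le> 1 * norm (f (of_real (R i * t)))"
          unfolding norm_mult using elim(2) S by (intro mult_right_mono) (auto simp: norm_power power_le_one)
        also have "\<dots> \<le> g t" using elim(1) R(1,2)[of i] by (simp add: less_imp_le)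
        finally show ?case .
      qed
    qed (rule g)
  qed simp
qed

text \<open>Each function has its own majorant, but \<open>K\<close> is common to all of
  \<open>X\<close>; this uniformity yields continuity. Closure under differences is assumed so that
  the majorant of \<open>G n - f\<close> can be used to estimate the difference of the two
  images.\<close>

lemma Imu_good_of_domination:
  assumes dom: "\<And>f. f \<in> X \<Longrightarrow> \<exists>g. radially_dominated \<mu> f g \<and> (\<integral>t. g t \<partial>\<mu>) \<le> K * nrm f"
    and diff: "\<And>f h. f \<in> X \<Longrightarrow> h \<in> X \<Longrightarrow> (\<lambda>z. f z - h z) \<in> X"
  shows "Imu_good \<mu> X nrm"
proof -
  define A where "A f n = (\<integral>t. of_real t ^ n * f (complex_of_real t) \<partial>\<mu>)" for f :: "complex \<Rightarrow> complex" and n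
  have sums: "(\<lambda>n. A f n * z ^ n) sums Imu \<mu> f z" if "f \<in> X" "z \<in> ball 0 1" for f z
    using dom[OF that(1)] Imu_sums that(2) unfolding A_def by auto
  have abel: "abel_sums (\<lambda>k. of_real (moment \<mu> (n + k)) * tcoeff f k) (A f n)" if "f \<in> X" for f n
    using dom[OF that(1)] abel_sums_moment_tcoeff unfolding A_def by blast
  have wd: "Imu_well_defined \<mu> X"
    unfolding Imu_well_defined_def
  proof (intro ballI conjI)
    fix f z assume "f \<in> X" "z \<in> ball (0::complex) 1"
    then show "integrable \<mu> (\<lambda>t. f (complex_of_real t) / (1 - complex_of_real t * z))"
      using dom[OF \<open>f \<in> X\<close>] Imu_kernel_integrable by auto
  next
    fix f assume "f \<in> X"
    then show "Imu \<mu> f holomorphic_on ball 0 1"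
      by (intro power_series_holomorphic[of 0 1 "A f"]) (use sums in auto)
  qed
  have cont: "Imu_continuous \<mu> X nrm"
    unfolding Imu_continuous_def
  proof (intro allI impI, elim conjE)
    fix G f K' assume G: "\<forall>n. G n \<in> X" and f: "f \<in> X" and lim: "(\<lambda>n. nrm (\<lambda>z. G n z - f z)) \<longlonglongrightarrow> 0"
      and K': "compact K'" "K' \<subseteq> ball (0::complex) 1"
    \<comment> \<open>\<open>\<rho>\<close> is the largest modulus on the compact set, or 0 if that
      set is empty; the kernel is then bounded by \<open>1 / (1 - \<rho>)\<close>
      throughout.\<close>
    obtain \<rho> where \<rho>: "\<rho> < 1" "\<And>z. z \<in> K' \<Longrightarrow> norm z \<le> \<rho>"
    proof (cases "K' = {}")
      case False
      then obtain z0 where "z0 \<in> K'" "\<And>z. z \<in> K' \<Longrightarrow> norm z \<le> norm z0"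
        using continuous_attains_sup[OF K'(1), of norm] by (auto intro: continuous_intros)
      then show ?thesis using that[of "norm z0"] K'(2) by auto
    qed (use that[of 0] in auto)
    have bound: "norm (Imu \<mu> (G n) z - Imu \<mu> f z) \<le> K * nrm (\<lambda>z. G n z - f z) / (1 - \<rho>)" if z: "z \<in> K'" for n z
    proof -
      have zb: "z \<in> ball 0 1" using z K' by auto
      have I: "integrable \<mu> (\<lambda>t. h (complex_of_real t) / (1 - complex_of_real t * z))" if "h \<in> X" for h
        using wd that zb unfolding Imu_well_defined_def by blast
      have d: "(\<lambda>z. G n z - f z) \<in> X" using diff G f by blast
      then obtain g where g: "radially_dominated \<mu> (\<lambda>z. G n z - f z) g" "(\<integral>t. g t \<partial>\<mu>) \<le> K * nrm (\<lambda>z. G n z - f z)"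
        using dom by blast
      then have gi: "integrable \<mu> g" unfolding radially_dominated_def by auto
      have "Imu \<mu> (G n) z - Imu \<mu> f z = (\<integral>t. (G n (complex_of_real t) - f (complex_of_real t)) / (1 - complex_of_real t * z) \<partial>\<mu>)"
        unfolding Imu_def using I[of "G n"] I[of f] G f by (simp add: diff_divide_distrib)
      also have "norm \<dots> \<le> (\<integral>t. g t / (1 - \<rho>) \<partial>\<mu>)"
      proof (rule order_trans[OF integral_norm_bound integral_mono_AE])
        show "integrable \<mu> (\<lambda>t. norm ((G n (complex_of_real t) - f (complex_of_real t)) / (1 - complex_of_real t * z)))"
          using I[OF d] by (intro integrable_norm) simp
        show "integrable \<mu> (\<lambda>t. g t / (1 - \<rho>))" using gi by auto
        have "AE t in \<mu>. \<forall>r\<in>{0..1}. norm (G n (complex_of_real (r * t)) - f (complex_of_real (r * t))) \<le> g t"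
          using g(1) unfolding radially_dominated_def by auto
        then show "AE t in \<mu>. norm ((G n (complex_of_real t) - f (complex_of_real t)) / (1 - complex_of_real t * z)) \<le> g t / (1 - \<rho>)"
          using AE_space
        proof eventually_elim
          case (elim t)
          then have "norm (G n (complex_of_real (1 * t)) - f (complex_of_real (1 * t))) \<le> g t"
            by (meson atLeastAtMost_iff order_refl zero_le_one)
          moreover have "norm (complex_of_real t * z) \<le> 1 * norm z"
            using elim(2) space_borel_measure_01[OF \<mu>] by (auto simp: norm_mult intro!: mult_left_le_one_le)
          then have "1 - \<rho> \<le> norm (1 - complex_of_real t * z)"
            using norm_triangle_ineq2[of 1 "complex_of_real t * z"] \<rho>(2)[OF z] by simp
          ultimately show ?case
            unfolding norm_divide using \<rho>(1) by (intro frac_le) (auto intro: order_trans[OF norm_ge_zero])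
        qed
      qed
      also have "\<dots> = (\<integral>t. g t \<partial>\<mu>) / (1 - \<rho>)" by simp
      also have "\<dots> \<le> K * nrm (\<lambda>z. G n z - f z) / (1 - \<rho>)" using g(2) \<rho>(1) by (intro divide_right_mono) auto
      finally show ?thesis .
    qed
    have lim0: "(\<lambda>n. K * nrm (\<lambda>z. G n z - f z) / (1 - \<rho>)) \<longlonglongrightarrow> K * 0 / (1 - \<rho>)"
      using \<rho>(1) by (intro tendsto_intros lim) auto
    show "uniform_limit K' (\<lambda>n. Imu \<mu> (G n)) (Imu \<mu> f) sequentially"
      unfolding uniform_limit_iff
    proof (intro allI impI)
      fix e :: real assume "e > 0"
      then have "\<forall>\<^sub>F n in sequentially. K * nrm (\<lambda>z. G n z - f z) / (1 - \<rho>) < e"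
        using order_tendstoD(2)[OF lim0, of e] by simp
      then show "\<forall>\<^sub>F n in sequentially. \<forall>x\<in>K'. dist (Imu \<mu> (G n) x) (Imu \<mu> f x) < e"
        by eventually_elim (use bound in \<open>auto simp: dist_norm intro: le_less_trans\<close>)
    qed
  qed
  \<comment> \<open>An ordinary sum is also the limit of the Abel means, and this limit is
    unique.\<close>
  have "A f n = (\<Sum>k. of_real (moment \<mu> (n + k)) * tcoeff f k)"
    if "f \<in> X" "summable (\<lambda>k. of_real (moment \<mu> (n + k)) * tcoeff f k)" for f n
    using abel[OF that(1), of n] Abel_limit[OF summable_sums[OF that(2)]] tendsto_unique[OF trivial_limit_at_left_real]
    unfolding abel_sums_def by blast
  then have "(\<lambda>n. (\<Sum>k. of_real (moment \<mu> (n + k)) * tcoeff f k) * z ^ n) sums Imu \<mu> f z"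
    if "f \<in> X" "\<forall>n. summable (\<lambda>k. of_real (moment \<mu> (n + k)) * tcoeff f k)" "z \<in> ball 0 1" for f z
    using sums[OF that(1,3)] that by simp
  moreover have "\<forall>f\<in>X. \<exists>A. (\<forall>n. abel_sums (\<lambda>k. of_real (moment \<mu> (n + k)) * tcoeff f k) (A n)) \<and>
                 (\<forall>z\<in>ball 0 1. (\<lambda>n. A n * z ^ n) sums Imu \<mu> f z)"
  proof
    fix f assume "f \<in> X"
    then show "\<exists>A. (\<forall>n. abel_sums (\<lambda>k. of_real (moment \<mu> (n + k)) * tcoeff f k) (A n)) \<and>
                 (\<forall>z\<in>ball 0 1. (\<lambda>n. A n * z ^ n) sums Imu \<mu> f z)"
      using abel sums by (intro exI[of _ "A f"]) simp
  qed
  ultimately show ?thesis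
    unfolding Imu_good_def using wd cont by simp
qed

text \<open>Since \<open>v\<close> does not increase with the modulus, \<open>v\<close> at
  \<open>t\<close> is at most \<open>v\<close> at \<open>r * t\<close>; hence the norm of
  \<open>f\<close> divided by \<open>v\<close> at \<open>t\<close> is a radial majorant, and
  \<open>K\<close> is the integral of \<open>1 / v\<close>.\<close>

lemma Imu_good_Hinf_v:
  assumes v: "weight v" and int: "integrable \<mu> (\<lambda>t. 1 / v (complex_of_real t))"
  shows "Imu_good \<mu> (Hinf_v v) (Hinf_v_norm v)"
proof (rule Imu_good_of_domination[where K = "\<integral>t. 1 / v (complex_of_real t) \<partial>\<mu>"])
  fix f assume f: "f \<in> Hinf_v v"
  have bd: "norm (f (complex_of_real (r * t))) \<le> Hinf_v_norm v f * (1 / v (complex_of_real t))"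
    if t: "t \<in> {0..<1}" and r: "r \<in> {0..1}" for t r
  proof -
    have rt: "r * t \<le> t" "0 \<le> r * t" using t r mult_left_le_one_le[of t r] by auto
    then have b: "complex_of_real (r * t) \<in> ball 0 1" "complex_of_real t \<in> ball 0 1" using t by (auto simp: norm_of_real simp del: of_real_mult)
    have "v (complex_of_real t) \<le> v (complex_of_real (r * t))"
      using v b rt t unfolding weight_def by (metis atLeastLessThan_iff abs_of_nonneg norm_of_real)
    then have "v (complex_of_real t) * norm (f (complex_of_real (r * t))) \<le> v (complex_of_real (r * t)) * norm (f (complex_of_real (r * t)))"
      by (intro mult_right_mono) auto
    also have "\<dots> \<le> Hinf_v_norm v f" by (rule Hinf_v_bound[OF f b(1)])
    finally have le: "v (complex_of_real t) * norm (f (complex_of_real (r * t))) \<le> Hinf_v_norm v f" .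
    have "0 < v (complex_of_real t)" by (rule weight_pos[OF v b(2)])
    then show ?thesis using le by (simp add: pos_le_divide_eq mult.commute)
  qed
  show "\<exists>g. radially_dominated \<mu> f g \<and> integral\<^sup>L \<mu> g \<le> (\<integral>t. 1 / v (complex_of_real t) \<partial>\<mu>) * Hinf_v_norm v f"
    unfolding radially_dominated_def
  proof (intro exI[of _ "\<lambda>t. Hinf_v_norm v f * (1 / v (complex_of_real t))"] conjI)
    show "AE t in \<mu>. \<forall>r\<in>{0..1}. norm (f (complex_of_real (r * t))) \<le> Hinf_v_norm v f * (1 / v (complex_of_real t))"
      using bd space_borel_measure_01[OF \<mu>] by (intro AE_I2) simp
    show "(\<integral>t. Hinf_v_norm v f * (1 / v (complex_of_real t)) \<partial>\<mu>) \<le> (\<integral>t. 1 / v (complex_of_real t) \<partial>\<mu>) * Hinf_v_norm v f"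
      using int by (subst integral_mult_right_zero) (simp add: mult.commute)
  qed (use f integrable_mult_right[OF int] in \<open>simp_all add: Hinf_v_def\<close>)
qed (rule Hinf_v_diff[OF v])

end

section \<open>Hilbert's inequality and zero-free majorants\<close>

text \<open>Two telescoping comparisons. For \<open>j \<le> i\<close> the denominator is at least
  \<open>i + 1\<close>, and \<open>1 / sqrt (j + 1)\<close> is at most twice the increment of the
  square root; these terms add up to at most 2. For \<open>j > i\<close> the denominator is at least
  \<open>j + 1\<close>, and the power -3/2 of \<open>j + 1\<close> is at most twice the decrement of
  the reciprocal square root; these add at most another 2.\<close>

lemma Schur_row_sum:
  fixes i N :: nat
  shows "(\<Sum>j<N. sqrt (real (Suc i) / real (Suc j)) / real (Suc (i + j))) \<le> 4"
proof -
  define a where "a = sqrt (real (Suc i))"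
  define S where "S N = (\<Sum>j<N. sqrt (real (Suc i) / real (Suc j)) / real (Suc (i + j)))" for N
  have a: "0 < a" "a ^ 2 = real (Suc i)" by (auto simp: a_def)
  have small: "S N \<le> 2 * sqrt (real N) / a" if "N \<le> Suc i" for N
    using that
  proof (induction N)
    case (Suc N)
    define p where "p = sqrt (real N)"
    define q where "q = sqrt (real (Suc N))"
    have pq: "0 \<le> p" "0 < q" "p \<le> q" "p ^ 2 = real N" "q ^ 2 = real N + 1" by (auto simp: p_def q_def)
    have "1 / q \<le> 2 * (q - p)"
    proof -
      have "1 = (q - p) * (q + p)" using pq by (simp add: power2_eq_square algebra_simps)
      also have "\<dots> \<le> (q - p) * (2 * q)" using pq by (intro mult_left_mono) auto
      finally show ?thesis using pq by (simp add: field_simps)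
    qed
    have "S (Suc N) = S N + (a / q) / real (Suc (i + N))" by (simp add: S_def a_def q_def real_sqrt_divide)
    also have "(a / q) / real (Suc (i + N)) \<le> (a / q) / a ^ 2" unfolding a(2) using a(1) pq by (intro divide_left_mono) auto
    also have "(a / q) / a ^ 2 = (1 / q) / a" using a(1) by (simp add: power2_eq_square)
    also have "\<dots> \<le> (2 * (q - p)) / a" using a(1) \<open>1 / q \<le> 2 * (q - p)\<close> by (intro divide_right_mono) auto
    also have "S N \<le> 2 * p / a" using Suc by (simp add: p_def)
    finally have "S (Suc N) \<le> 2 * q / a" by (simp add: diff_divide_distrib right_diff_distrib)
    then show ?case unfolding q_def .
  qed (simp add: S_def)
  \<comment> \<open>At \<open>k = 0\<close> the right-hand side equals 2, which is where the first
    estimate ends; from there the reciprocal square roots telescope.\<close>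
  have large: "S (Suc i + k) \<le> 4 - 2 * a / sqrt (real (Suc i + k))" for k
  proof (induction k)
    case 0
    have "S (Suc i) \<le> 2 * a / a" using small[of "Suc i"] by (simp only: a_def order_refl)
    then show ?case using a(1) unfolding add_0_right a_def[symmetric] by simp
  next
    case (Suc k)
    define p where "p = sqrt (real (Suc i + k))"
    define q where "q = sqrt (real (Suc i + Suc k))"
    have pq: "0 < p" "0 < q" "p \<le> q" "p ^ 2 = real (Suc i + k)" "q ^ 2 = p ^ 2 + 1" by (auto simp: p_def q_def)
    have "1 / (q * q ^ 2) \<le> 2 * (1 / p - 1 / q)"
    proof -
      have "1 = (q - p) * (q + p)" using pq by (simp add: power2_eq_square algebra_simps)
      also have "\<dots> \<le> (q - p) * (2 * q)" using pq by (intro mult_left_mono) auto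
      finally have "1 / (2 * q) \<le> q - p" using pq by (simp add: field_simps)
      then have "2 * ((1 / (2 * q)) / (q * q)) \<le> 2 * ((q - p) / (p * q))"
        using pq by (intro mult_left_mono frac_le mult_right_mono) auto
      moreover have "2 * ((1 / (2 * q)) / (q * q)) = 1 / (q * q ^ 2)" by (simp add: power2_eq_square)
      moreover have "(q - p) / (p * q) = 1 / p - 1 / q" using pq(1,2) by (simp add: diff_divide_distrib)
      ultimately show ?thesis by (simp only:)
    qed
    have "S (Suc i + Suc k) = S (Suc i + k) + (a / q) / real (Suc (i + (Suc i + k)))"
      by (simp add: S_def a_def q_def real_sqrt_divide)
    also have "(a / q) / real (Suc (i + (Suc i + k))) \<le> (a / q) / q ^ 2"
      using a(1) pq by (intro divide_left_mono) auto
    also have "(a / q) / q ^ 2 = a * (1 / (q * q ^ 2))" by simp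
    also have "\<dots> \<le> a * (2 * (1 / p - 1 / q))" using a(1) \<open>1 / (q * q ^ 2) \<le> _\<close> by (intro mult_left_mono) auto
    also have "S (Suc i + k) \<le> 4 - 2 * a / p" using Suc by (simp add: p_def)
    finally have "S (Suc i + Suc k) \<le> 4 - 2 * a / q" by (simp add: algebra_simps)
    then show ?case unfolding q_def .
  qed
  show ?thesis
  proof (cases "N \<le> Suc i")
    case True
    then have "sqrt (real N) \<le> a" unfolding a_def by (intro real_sqrt_le_mono) auto
    then have "2 * sqrt (real N) / a \<le> 2" using a(1) by (simp add: field_simps)
    then show ?thesis using small[OF True] by (simp add: S_def)
  next
    case False
    then obtain k where "N = Suc i + k" by (metis le_add_diff_inverse nat_le_linear)
    moreover have "0 \<le> 2 * a / sqrt (real (Suc i + k))" using a(1) by simp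
    ultimately show ?thesis using large[of k] by (simp add: S_def)
  qed
qed

text \<open>Schur's test: each product is split by the inequality of arithmetic and geometric means
  with the weights \<open>w i j\<close> and \<open>w j i\<close>, which are reciprocal. After
  swapping the sums in one half, both halves are controlled by the same row sums. The constant 4
  stands in for the sharp \<open>pi\<close>.\<close>

lemma Hilbert_inequality:
  fixes x :: "nat \<Rightarrow> real"
  shows "(\<Sum>i<N. \<Sum>j<N. x i * x j / real (Suc (i + j))) \<le> 4 * (\<Sum>i<N. (x i)\<^sup>2)"
proof -
  define w where "w i j = sqrt (real (Suc i) / real (Suc j))" for i j
  have wpos: "0 < w i j" for i j by (simp add: w_def)
  have winv: "1 / w i j = w j i" for i j by (simp add: w_def real_sqrt_divide)
  have amgm: "x i * x j \<le> ((x i)\<^sup>2 * w i j + (x j)\<^sup>2 * w j i) / 2" for i j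
  proof -
    have "0 \<le> (x i * w i j - x j)\<^sup>2 / w i j" using wpos[of i j] by simp
    also have "\<dots> = (x i)\<^sup>2 * w i j + (x j)\<^sup>2 * (1 / w i j) - 2 * (x i * x j)"
      using wpos[of i j] by (simp add: field_simps power2_eq_square)
    finally show ?thesis unfolding winv by simp
  qed
  have "(\<Sum>i<N. \<Sum>j<N. x i * x j / real (Suc (i + j))) \<le>
    (\<Sum>i<N. \<Sum>j<N. ((x i)\<^sup>2 * w i j + (x j)\<^sup>2 * w j i) / 2 / real (Suc (i + j)))"
    by (intro sum_mono divide_right_mono amgm) auto
  also have "\<dots> = (\<Sum>i<N. \<Sum>j<N. (x i)\<^sup>2 * w i j / 2 / real (Suc (i + j))) +
      (\<Sum>i<N. \<Sum>j<N. (x j)\<^sup>2 * w j i / 2 / real (Suc (i + j)))"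
    by (simp add: add_divide_distrib sum.distrib)
  also have "(\<Sum>i<N. \<Sum>j<N. (x j)\<^sup>2 * w j i / 2 / real (Suc (i + j))) =
      (\<Sum>i<N. \<Sum>j<N. (x i)\<^sup>2 * w i j / 2 / real (Suc (i + j)))"
    by (subst sum.swap) (simp add: add.commute)
  also have "(\<Sum>i<N. \<Sum>j<N. (x i)\<^sup>2 * w i j / 2 / real (Suc (i + j))) +
      (\<Sum>i<N. \<Sum>j<N. (x i)\<^sup>2 * w i j / 2 / real (Suc (i + j))) =
      (\<Sum>i<N. (x i)\<^sup>2 * (\<Sum>j<N. w i j / real (Suc (i + j))))"
    unfolding sum.distrib[symmetric] sum_distrib_left by (intro sum.cong refl) (simp del: of_nat_Suc)
  also have "\<dots> \<le> (\<Sum>i<N. (x i)\<^sup>2 * 4)"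
    unfolding w_def by (intro sum_mono mult_left_mono Schur_row_sum) auto
  finally show ?thesis by (simp add: sum_distrib_left mult.commute)
qed

section \<open>Reflection of roots and zero-free majorants\<close>

text \<open>The difference of the squared moduli factors as
  \<open>(1 - (norm z)\<^sup>2) * (1 - (norm \<alpha>)\<^sup>2)\<close>, which is nonnegative on the
  closed disc and vanishes on the circle. This is the bound for a Blaschke factor, stated without a
  quotient.\<close>

lemma norm_diff_le_norm_one_minus_cnj_mult:
  fixes z \<alpha> :: complex
  assumes "norm z \<le> 1" "norm \<alpha> \<le> 1"
  shows "norm (z - \<alpha>) \<le> norm (1 - cnj \<alpha> * z)"
    and "norm z = 1 \<Longrightarrow> norm (z - \<alpha>) = norm (1 - cnj \<alpha> * z)"
proof -
  have eq: "(norm (1 - cnj \<alpha> * z))\<^sup>2 - (norm (z - \<alpha>))\<^sup>2 = (1 - (norm z)\<^sup>2) * (1 - (norm \<alpha>)\<^sup>2)"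
    unfolding cmod_power2 by (simp add: power2_eq_square algebra_simps)
  have "0 \<le> (1 - (norm z)\<^sup>2) * (1 - (norm \<alpha>)\<^sup>2)"
    using assms by (intro mult_nonneg_nonneg) (auto simp: abs_square_le_1)
  then have "(norm (z - \<alpha>))\<^sup>2 \<le> (norm (1 - cnj \<alpha> * z))\<^sup>2" using eq by linarith
  then show "norm (z - \<alpha>) \<le> norm (1 - cnj \<alpha> * z)" by (rule power2_le_imp_le) simp
  show "norm (z - \<alpha>) = norm (1 - cnj \<alpha> * z)" if "norm z = 1"
    using eq that by simp
qed

text \<open>A root \<open>\<alpha>\<close> inside the disc is replaced by its reflection, i.e. \<open>z - \<alpha>\<close> by \<open>1 - cnj \<alpha> z\<close>.\<close>

lemma zero_free_majorant:
  fixes p :: "complex poly"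
  assumes "p \<noteq> 0"
  shows "\<exists>q. (\<forall>z. norm z < 1 \<longrightarrow> poly q z \<noteq> 0) \<and> (\<forall>z. norm z \<le> 1 \<longrightarrow> norm (poly p z) \<le> norm (poly q z)) \<and>
             (\<forall>z. norm z = 1 \<longrightarrow> norm (poly p z) = norm (poly q z))"
  using assms
proof (induction "degree p" arbitrary: p)
  case 0
  then obtain c where "p = [:c:]" by (metis degree_eq_zeroE)
  then show ?case using 0 by (intro exI[of _ p]) auto
next
  case (Suc n)
  have "\<not> constant (poly p)"
    using Suc.hyps(2) by (metis constant_degree Zero_not_Suc)
  then obtain \<alpha> where "poly p \<alpha> = 0" using Fundamental_Theorem_Algebra.fundamental_theorem_of_algebra[of p] by blast
  then obtain p' where p': "p = [:- \<alpha>, 1:] * p'" unfolding poly_eq_0_iff_dvd by (rule dvdE)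
  then have "p' \<noteq> 0" using Suc.prems by auto
  moreover have "n = degree p'"
    using Suc.hyps(2) \<open>p' \<noteq> 0\<close> unfolding p' by (subst (asm) degree_mult_eq) auto
  ultimately obtain q' where q': "\<And>z. norm z < 1 \<Longrightarrow> poly q' z \<noteq> 0"
    "\<And>z. norm z \<le> 1 \<Longrightarrow> norm (poly p' z) \<le> norm (poly q' z)" "\<And>z. norm z = 1 \<Longrightarrow> norm (poly p' z) = norm (poly q' z)"
    using Suc.hyps(1) by blast
  have pz: "poly p z = (z - \<alpha>) * poly p' z" for z by (simp add: p' algebra_simps)
  show ?case
  proof (cases "norm \<alpha> < 1")
    case True
    have nz: "1 - cnj \<alpha> * z \<noteq> 0" if "norm z < 1" for z
    proof -
      have "norm (cnj \<alpha> * z) \<le> 1 * norm z" unfolding norm_mult using True by (intro mult_right_mono) auto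
      then show ?thesis using that by auto
    qed
    have qz: "poly ([:1, - cnj \<alpha>:] * q') z = (1 - cnj \<alpha> * z) * poly q' z" for z by (simp add: algebra_simps)
    note key = norm_diff_le_norm_one_minus_cnj_mult[of _ \<alpha>]
    show ?thesis
      by (intro exI[of _ "[:1, - cnj \<alpha>:] * q'"], unfold qz pz norm_mult)
        (use q' nz key True in \<open>auto intro!: mult_mono\<close>)
  next
    \<comment> \<open>A root of modulus at least 1 is no zero in the open disc, so its factor is
      kept unchanged.\<close>
    case False
    have qz: "poly ([:- \<alpha>, 1:] * q') z = (z - \<alpha>) * poly q' z" for z by (simp add: algebra_simps)
    show ?thesis
      by (intro exI[of _ "[:- \<alpha>, 1:] * q'"], unfold qz pz norm_mult)
        (use q' False in \<open>auto intro!: mult_left_mono\<close>)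
  qed
qed

section \<open>Orthogonality and Parseval's identity on circles\<close>

lemma has_integral_cis_multiple:
  fixes k :: int
  shows "((\<lambda>\<theta>. cis (of_int k * \<theta>)) has_integral (if k = 0 then of_real (2 * pi) else 0)) {0..2 * pi}"
proof (cases "k = 0")
  case True
  then show ?thesis using has_integral_const_real[of "1::complex" 0 "2 * pi"] by (simp add: scaleR_conv_of_real)
next
  case False
  let ?F = "\<lambda>\<theta>. cis (of_int k * \<theta>) / (\<i> * of_int k)"
  have "(?F has_vector_derivative cis (of_int k * \<theta>)) (at \<theta> within {0..2 * pi})" for \<theta>
  proof -
    have "((\<lambda>\<theta>. exp (\<i> * of_int k * of_real \<theta>) / (\<i> * of_int k)) has_vector_derivative exp (\<i> * of_int k * of_real \<theta>)) (at \<theta> within {0..2 * pi})"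
      by (rule has_vector_derivative_eq_rhs[OF has_vector_derivative_real_field[where f = "\<lambda>z. exp (\<i> * of_int k * z) / (\<i> * of_int k)"]])
        (use False in \<open>auto intro!: derivative_eq_intros simp: field_simps\<close>)
    then show ?thesis by (simp add: cis_conv_exp mult_ac)
  qed
  then have "((\<lambda>\<theta>. cis (of_int k * \<theta>)) has_integral (?F (2 * pi) - ?F 0)) {0..2 * pi}"
    by (intro fundamental_theorem_of_calculus) auto
  moreover have "cis (of_int k * (2 * pi)) = 1"
    using cis_multiple_2pi[of "of_int k"] by (simp add: mult_ac)
  ultimately show ?thesis using False by simp
qed

text \<open>Parseval's identity: the squared modulus is expanded into a double sum, and
  orthogonality leaves only the diagonal.\<close>

lemma has_integral_norm_trig_poly:
  fixes c :: "nat \<Rightarrow> complex"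
  shows "((\<lambda>\<theta>. (norm (\<Sum>n<N. c n * cis \<theta> ^ n))\<^sup>2) has_integral (2 * pi * (\<Sum>n<N. (norm (c n))\<^sup>2))) {0..2 * pi}"
proof -
  have eq: "complex_of_real ((norm (\<Sum>n<N. c n * cis \<theta> ^ n))\<^sup>2) =
     (\<Sum>n<N. \<Sum>k<N. c n * cnj (c k) * cis (of_int (int n - int k) * \<theta>))" for \<theta>
  proof -
    have "complex_of_real ((norm (\<Sum>n<N. c n * cis \<theta> ^ n))\<^sup>2) = (\<Sum>n<N. c n * cis \<theta> ^ n) * cnj (\<Sum>k<N. c k * cis \<theta> ^ k)"
      by (rule complex_norm_square)
    also have "\<dots> = (\<Sum>n<N. \<Sum>k<N. (c n * cis \<theta> ^ n) * cnj (c k * cis \<theta> ^ k))"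
      by (simp add: sum_product)
    also have "\<dots> = (\<Sum>n<N. \<Sum>k<N. c n * cnj (c k) * cis (of_int (int n - int k) * \<theta>))"
    proof (intro sum.cong refl)
      fix n k
      have "cis \<theta> ^ n * cnj (cis \<theta> ^ k) = cis (of_int (int n - int k) * \<theta>)"
        unfolding Complex.DeMoivre cis_cnj cis_mult by (simp add: left_diff_distrib)
      then show "c n * cis \<theta> ^ n * cnj (c k * cis \<theta> ^ k) = c n * cnj (c k) * cis (of_int (int n - int k) * \<theta>)"
        by (metis complex_cnj_mult mult.assoc mult.left_commute)
    qed
    finally show ?thesis .
  qed
  have "((\<lambda>\<theta>. \<Sum>n<N. \<Sum>k<N. c n * cnj (c k) * cis (of_int (int n - int k) * \<theta>)) has_integral
     (\<Sum>n<N. \<Sum>k<N. c n * cnj (c k) * (if int n - int k = 0 then of_real (2 * pi) else 0))) {0..2 * pi}"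
    by (intro has_integral_sum has_integral_mult_right has_integral_cis_multiple) auto
  also have "(\<Sum>n<N. \<Sum>k<N. c n * cnj (c k) * (if int n - int k = 0 then of_real (2 * pi) else 0)) =
     of_real (2 * pi * (\<Sum>n<N. (norm (c n))\<^sup>2))"
  proof -
    have "(\<Sum>k<N. c n * cnj (c k) * (if int n - int k = 0 then of_real (2 * pi) else 0)) = of_real (2 * pi * (norm (c n))\<^sup>2)" if "n < N" for n
    proof -
      have "(\<Sum>k<N. c n * cnj (c k) * (if int n - int k = 0 then of_real (2 * pi) else 0)) =
        (\<Sum>k<N. if k = n then c n * cnj (c n) * of_real (2 * pi) else 0)"
        by (intro sum.cong) auto
      also have "\<dots> = c n * cnj (c n) * of_real (2 * pi)" using that by simp
      also have "\<dots> = of_real (2 * pi * (norm (c n))\<^sup>2)"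
        unfolding of_real_mult[of "2 * pi"] complex_norm_square by (simp add: mult.commute)
      finally show ?thesis .
    qed
    then show ?thesis by (simp add: sum_distrib_left)
  qed
  finally have "((\<lambda>\<theta>. complex_of_real ((norm (\<Sum>n<N. c n * cis \<theta> ^ n))\<^sup>2)) has_integral of_real (2 * pi * (\<Sum>n<N. (norm (c n))\<^sup>2))) {0..2 * pi}"
    unfolding eq[symmetric] .
  from has_integral_linear[OF this bounded_linear_Re] show ?thesis by (simp only: o_def Re_complex_of_real)
qed

text \<open>On the circle of radius \<open>\<rho>\<close> the Taylor partial sums converge
  uniformly, so their square integrals converge to that of \<open>g\<close>. By Parseval these
  integrals increase with the number of terms, hence each is at most the limit.\<close>

lemma tcoeff_square_sum_le:
  assumes hol: "g holomorphic_on ball 0 1" and \<rho>: "0 \<le> \<rho>" "\<rho> < 1"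
  shows "2 * pi * (\<Sum>n<N. (norm (tcoeff g n) * \<rho> ^ n)\<^sup>2) \<le> integral {0..2 * pi} (\<lambda>\<theta>. (norm (g (of_real \<rho> * cis \<theta>)))\<^sup>2)"
proof -
  define c where "c n = tcoeff g n * of_real \<rho> ^ n" for n
  have nc: "norm (c n) = norm (tcoeff g n) * \<rho> ^ n" for n using \<rho> by (simp add: c_def norm_mult norm_power)
  define S where "S M \<theta> = (\<Sum>n<M. c n * cis \<theta> ^ n)" for M \<theta>
  have sm: "summable (\<lambda>n. norm (c n))" unfolding nc by (rule tcoeff_abs_summable[OF hol \<rho>])
  have "uniform_limit UNIV (\<lambda>M \<theta>. S M \<theta>) (\<lambda>\<theta>. \<Sum>n. c n * cis \<theta> ^ n) sequentially"
    unfolding S_def by (rule Weierstrass_m_test[OF _ sm]) (simp add: norm_mult norm_power)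
  moreover have "(\<Sum>n. c n * cis \<theta> ^ n) = g (of_real \<rho> * cis \<theta>)" for \<theta>
    using tcoeff_sums[OF hol, of "of_real \<rho> * cis \<theta>"] \<rho>
    by (simp add: c_def sums_iff norm_mult power_mult_distrib mult_ac)
  ultimately have ul: "uniform_limit UNIV S (\<lambda>\<theta>. g (of_real \<rho> * cis \<theta>)) sequentially" by simp
  have ul2: "uniform_limit {0..2 * pi} (\<lambda>M \<theta>. (norm (S M \<theta>))\<^sup>2) (\<lambda>\<theta>. (norm (g (of_real \<rho> * cis \<theta>)))\<^sup>2) sequentially"
  proof -
    have n: "uniform_limit {0..2 * pi} (\<lambda>M \<theta>. norm (S M \<theta>)) (\<lambda>\<theta>. norm (g (of_real \<rho> * cis \<theta>))) sequentially"
      by (rule uniform_limit_norm[OF uniform_limit_on_subset[OF ul]]) simp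
    have cont: "continuous_on {0..2 * pi} (\<lambda>\<theta>. norm (g (of_real \<rho> * cis \<theta>)))"
      using \<rho> by (intro continuous_on_norm continuous_on_compose2[OF holomorphic_on_imp_continuous_on[OF hol]] continuous_intros)
        (auto simp: norm_mult)
    have bd: "bounded ((\<lambda>\<theta>. norm (g (of_real \<rho> * cis \<theta>))) ` {0..2 * pi})"
      by (intro compact_imp_bounded compact_continuous_image cont) simp
    show ?thesis
      unfolding power2_eq_square by (rule uniform_lim_mult[OF n n bd bd])
  qed
  have contS: "continuous_on {0..2 * pi} (\<lambda>\<theta>. (norm (S M \<theta>))\<^sup>2)" for M
    unfolding S_def by (intro continuous_intros)
  obtain I J where I: "\<And>M. ((\<lambda>\<theta>. (norm (S M \<theta>))\<^sup>2) has_integral I M) {0..2 * pi}"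
    and J: "((\<lambda>\<theta>. (norm (g (of_real \<rho> * cis \<theta>)))\<^sup>2) has_integral J) {0..2 * pi}" and IJ: "I \<longlonglongrightarrow> J"
    using uniform_limit_integral[OF ul2 contS] by auto
  have IM: "I M = 2 * pi * (\<Sum>n<M. (norm (tcoeff g n) * \<rho> ^ n)\<^sup>2)" for M
    using has_integral_unique[OF I[of M] has_integral_norm_trig_poly[of c M, folded S_def]] unfolding nc .
  have "I N \<le> J"
  proof (rule incseq_le[OF _ IJ])
    show "incseq I" unfolding IM by (intro incseq_SucI) simp
  qed
  then show ?thesis using integral_unique[OF J] IM by simp
qed

text \<open>The \<open>x n\<close> are the moduli of the Taylor coefficients of a holomorphic square
  root of the zero-free majorant of \<open>p\<close>. The square turns a mean of first powers into a
  sum of squares, which is the form that Hilbert's inequality accepts.\<close>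

lemma poly_square_majorant:
  fixes p :: "complex poly"
  obtains x :: "nat \<Rightarrow> real" where "\<And>n. 0 \<le> x n"
    "\<And>N. (\<Sum>n<N. (x n)\<^sup>2) \<le> 1 / (2 * pi) * integral {0..2 * pi} (\<lambda>\<theta>. norm (poly p (cis \<theta>)))"
    "\<And>s. 0 \<le> s \<Longrightarrow> s < 1 \<Longrightarrow> summable (\<lambda>n. x n * s ^ n)"
    "\<And>s. 0 \<le> s \<Longrightarrow> s < 1 \<Longrightarrow> norm (poly p (of_real s)) \<le> (\<Sum>n. x n * s ^ n)\<^sup>2"
proof (cases "p = 0")
  case True
  then show ?thesis by (intro that[of "\<lambda>_. 0"]) auto
next
  case False
  obtain q where q: "\<And>z. norm z < 1 \<Longrightarrow> poly q z \<noteq> 0" "\<And>z. norm z \<le> 1 \<Longrightarrow> norm (poly p z) \<le> norm (poly q z)"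
    "\<And>z. norm z = 1 \<Longrightarrow> norm (poly p z) = norm (poly q z)"
    using zero_free_majorant[OF False] by blast
  \<comment> \<open>The disc is contractible and \<open>q\<close> has no zeros in it, so a
    holomorphic square root exists.\<close>
  obtain g where g: "g holomorphic_on ball 0 1" "\<And>z. z \<in> ball 0 1 \<Longrightarrow> poly q z = g z ^ 2"
    by (rule contractible_imp_holomorphic_sqrt[of "poly q" "ball 0 1"])
       (use q(1) in \<open>auto intro!: holomorphic_intros convex_imp_contractible\<close>)
  define x where "x n = norm (tcoeff g n)" for n
  define Q where "Q \<rho> = integral {0..2 * pi} (\<lambda>\<theta>. norm (poly q (of_real \<rho> * cis \<theta>)))" for \<rho>
  have contQ: "continuous_on UNIV Q"
    unfolding Q_def interval_cbox
    by (intro integral_continuous_on_param) (auto intro!: continuous_intros simp: split_beta)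
  have le: "(\<Sum>n<N. (x n * \<rho> ^ n)\<^sup>2) \<le> 1 / (2 * pi) * Q \<rho>" if \<rho>: "0 \<le> \<rho>" "\<rho> < 1" for N \<rho>
  proof -
    have "(norm (g (of_real \<rho> * cis \<theta>)))\<^sup>2 = norm (poly q (of_real \<rho> * cis \<theta>))" for \<theta>
      using g(2)[of "of_real \<rho> * cis \<theta>"] \<rho> by (simp add: norm_mult norm_power)
    then have "2 * pi * (\<Sum>n<N. (x n * \<rho> ^ n)\<^sup>2) \<le> Q \<rho>"
      using tcoeff_square_sum_le[OF g(1) \<rho>, of N] by (simp add: x_def Q_def)
    then show ?thesis by (simp add: field_simps)
  qed
  show ?thesis
  proof (rule that[of x])
    show "0 \<le> x n" for n by (simp add: x_def)
    show sm: "summable (\<lambda>n. x n * s ^ n)" if "0 \<le> s" "s < 1" for s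
      unfolding x_def by (rule tcoeff_abs_summable[OF g(1) that])
    show "norm (poly p (of_real s)) \<le> (\<Sum>n. x n * s ^ n)\<^sup>2" if s: "0 \<le> s" "s < 1" for s
    proof -
      have "norm (g (of_real s)) \<le> (\<Sum>n. norm (tcoeff g n * of_real s ^ n))"
        using tcoeff_sums[OF g(1), of "of_real s"] sm[OF s] s
          summable_norm[of "\<lambda>n. tcoeff g n * of_real s ^ n"]
        by (simp add: sums_iff x_def norm_mult norm_power)
      then have *: "norm (g (of_real s)) \<le> (\<Sum>n. x n * s ^ n)" using s by (simp add: norm_mult norm_power x_def)
      have "norm (poly p (of_real s)) \<le> norm (poly q (of_real s))" using s by (intro q) auto
      also have "\<dots> = norm (g (of_real s)) ^ 2" using g(2)[of "of_real s"] s by (simp add: norm_power)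
      also have "\<dots> \<le> (\<Sum>n. x n * s ^ n)\<^sup>2" using * by (intro power_mono) auto
      finally show ?thesis .
    qed
    fix N
    \<comment> \<open>The square root lives on the open disc only, so the estimate is first proved
      for \<open>\<rho> < 1\<close>. Both sides extend continuously to \<open>\<rho> = 1\<close>
      because \<open>q\<close> is a polynomial, and there \<open>q\<close> and \<open>p\<close> have
      equal modulus.\<close>
    have "(\<Sum>n<N. (x n * 1 ^ n)\<^sup>2) \<le> 1 / (2 * pi) * Q 1"
    proof (rule tendsto_le[OF trivial_limit_at_left_real])
      show "((\<lambda>\<rho>. \<Sum>n<N. (x n * \<rho> ^ n)\<^sup>2) \<longlongrightarrow> (\<Sum>n<N. (x n * 1 ^ n)\<^sup>2)) (at_left 1)"
        by (intro tendsto_intros)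
      have "(Q \<longlongrightarrow> Q 1) (at_left 1)"
        using contQ by (metis UNIV_I continuous_on_def tendsto_within_subset top_greatest)
      then show "((\<lambda>\<rho>. 1 / (2 * pi) * Q \<rho>) \<longlongrightarrow> 1 / (2 * pi) * Q 1) (at_left 1)" by (intro tendsto_intros)
      show "\<forall>\<^sub>F \<rho> in at_left 1. (\<Sum>n<N. (x n * \<rho> ^ n)\<^sup>2) \<le> 1 / (2 * pi) * Q \<rho>"
        unfolding eventually_at_left_field by (intro exI[of _ 0]) (use le in auto)
    qed
    then show "(\<Sum>n<N. (x n)\<^sup>2) \<le> 1 / (2 * pi) * integral {0..2 * pi} (\<lambda>\<theta>. norm (poly p (cis \<theta>)))"
      using q(3) by (simp add: Q_def)
  qed
qed

section \<open>Carleson measures and the Hardy space\<close>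

text \<open>The Landau bound holds only to the right of some \<open>b\<close>. For
  \<open>t \<le> b\<close> the total mass \<open>M\<close> is at most \<open>M / (1 - b)\<close>
  times \<open>1 - t\<close>; adding the two constants covers both ranges.\<close>

lemma carleson_tail_bound:
  assumes \<mu>: "borel_measure_01 \<mu>" and "carleson \<mu>"
  obtains C where "0 < C" "\<And>t. 0 \<le> t \<Longrightarrow> t < 1 \<Longrightarrow> measure \<mu> {t..<1} \<le> C * (1 - t)"
proof -
  interpret finite_measure \<mu> using \<mu> unfolding borel_measure_01_def by simp
  obtain c where c: "c > 0" "\<forall>\<^sub>F t in at_left 1. norm (measure \<mu> {t..<1}) \<le> c * norm (1 - t)"
    using assms(2) unfolding carleson_def by (elim landau_o.bigE)
  then obtain b where b: "b < 1" "\<And>t. b < t \<Longrightarrow> t < 1 \<Longrightarrow> measure \<mu> {t..<1} \<le> c * (1 - t)"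
    by (fastforce simp: eventually_at_left_field)
  define M where "M = measure \<mu> (space \<mu>)"
  show ?thesis
  proof (rule that[of "c + M / (1 - b)"])
    have M0: "0 \<le> M / (1 - b)" using b(1) by (simp add: M_def)
    then show "0 < c + M / (1 - b)" using c(1) by simp
    fix t :: real assume t: "0 \<le> t" "t < 1"
    show "measure \<mu> {t..<1} \<le> (c + M / (1 - b)) * (1 - t)"
    proof (cases "b < t")
      case True
      have "measure \<mu> {t..<1} \<le> c * (1 - t)" using b(2) True t by simp
      also have "\<dots> \<le> (c + M / (1 - b)) * (1 - t)" using M0 t by (intro mult_right_mono) auto
      finally show ?thesis .
    next
      case False
      have "measure \<mu> {t..<1} \<le> M" unfolding M_def by (rule bounded_measure)
      also have "M = M / (1 - b) * (1 - b)" using b(1) by simp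
      also have "\<dots> \<le> (c + M / (1 - b)) * (1 - t)" using M0 False c(1) b(1) t by (intro mult_mono) auto
      finally show ?thesis .
    qed
  qed
qed

text \<open>Layer-cake formula: \<open>t ^ n\<close> is the integral of
  \<open>n * s ^ (n - 1)\<close> over [0,t], and Fubini turns the moment into the integral of
  \<open>n * s ^ (n - 1)\<close> times the tail mass at \<open>s\<close>. With the tail bound this
  is at most \<open>C * (1 - n / (n + 1))\<close>, that is \<open>C / (n + 1)\<close>.\<close>

lemma moment_le_of_tail_bound:
  assumes \<mu>: "borel_measure_01 \<mu>" and tail: "\<And>t. 0 \<le> t \<Longrightarrow> t < 1 \<Longrightarrow> measure \<mu> {t..<1} \<le> C * (1 - t)"
  shows "moment \<mu> n \<le> C / real (Suc n)"
proof -
  interpret finite_measure \<mu> using \<mu> unfolding borel_measure_01_def by simp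
  note S = space_borel_measure_01[OF \<mu>]
  have C0: "0 \<le> C" using order_trans[OF measure_nonneg tail[of 0]] by simp
  show ?thesis
  proof (cases n)
    case 0
    then show ?thesis using tail[of 0] by (simp add: moment_def S)
  next
    case (Suc k)
    have [measurable]: "(\<lambda>t. t) \<in> borel_measurable \<mu>" by (intro borel_measurable_01_continuous[OF \<mu>] continuous_intros)
    interpret L: pair_sigma_finite \<mu> lborel ..
    have "(\<integral>\<^sup>+t. ennreal (t ^ n) \<partial>\<mu>) = (\<integral>\<^sup>+t. \<integral>\<^sup>+s. ennreal (real n * s ^ k) * indicator {0..t} s \<partial>lborel \<partial>\<mu>)"
    proof (rule nn_integral_cong)
      fix t assume "t \<in> space \<mu>"
      then have t: "0 \<le> t" using S by simp
      have "(\<integral>\<^sup>+s. ennreal (real n * s ^ k) * indicator {0..t} s \<partial>lborel) = ennreal (t ^ n - 0 ^ n)"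
        by (rule nn_integral_FTC_Icc) (use t Suc in \<open>auto intro!: DERIV_cong[OF DERIV_pow] simp del: power_Suc\<close>)
      then show "ennreal (t ^ n) = (\<integral>\<^sup>+s. ennreal (real n * s ^ k) * indicator {0..t} s \<partial>lborel)"
        using Suc by simp
    qed
    also have "\<dots> = (\<integral>\<^sup>+s. \<integral>\<^sup>+t. ennreal (real n * s ^ k) * indicator {0..t} s \<partial>\<mu> \<partial>lborel)"
    proof (rule L.Fubini'[symmetric])
      \<comment> \<open>Written as a condition on the pair, the integrand is visibly measurable in
        both variables jointly.\<close>
      have "(\<lambda>(t, s). ennreal (real n * s ^ k) * indicator {0..t} s) =
        (\<lambda>(t, s). if 0 \<le> s \<and> s \<le> t then ennreal (real n * s ^ k) else 0)" by (auto simp: fun_eq_iff indicator_def)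
      then show "(\<lambda>(t, s). ennreal (real n * s ^ k) * indicator {0..t} s) \<in> borel_measurable (\<mu> \<Otimes>\<^sub>M lborel)" by simp
    qed
    also have "\<dots> \<le> (\<integral>\<^sup>+s. ennreal (C * (real n * s ^ k * (1 - s))) * indicator {0..1} s \<partial>lborel)"
    proof (rule nn_integral_mono)
      fix s :: real
      show "(\<integral>\<^sup>+t. ennreal (real n * s ^ k) * indicator {0..t} s \<partial>\<mu>) \<le> ennreal (C * (real n * s ^ k * (1 - s))) * indicator {0..1} s"
      proof (cases "0 \<le> s \<and> s < 1")
        case True
        have "{0..<1} \<inter> {s..<1} \<in> sets (restrict_space borel {0..<1})"
          unfolding sets_restrict_space by (rule imageI) simp
        moreover have "{0..<1} \<inter> {s..<1} = {s..<1}" using True by auto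
        ultimately have "{s..<1} \<in> sets \<mu>" using \<mu> unfolding borel_measure_01_def by simp
        moreover have "(\<integral>\<^sup>+t. ennreal (real n * s ^ k) * indicator {0..t} s \<partial>\<mu>) =
            (\<integral>\<^sup>+t. ennreal (real n * s ^ k) * indicator {s..<1} t \<partial>\<mu>)"
          by (intro nn_integral_cong) (use S True in \<open>auto simp: indicator_def\<close>)
        ultimately have "(\<integral>\<^sup>+t. ennreal (real n * s ^ k) * indicator {0..t} s \<partial>\<mu>) = ennreal (real n * s ^ k) * emeasure \<mu> {s..<1}"
          by (simp add: nn_integral_cmult_indicator)
        also have "\<dots> = ennreal (real n * s ^ k * measure \<mu> {s..<1})"
          using True by (simp add: emeasure_eq_measure ennreal_mult)
        also have "\<dots> \<le> ennreal (real n * s ^ k * (C * (1 - s)))"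
          using True tail by (intro ennreal_leI mult_left_mono) auto
        finally show ?thesis using True by (simp add: mult_ac)
      next
        case False
        then have "(\<integral>\<^sup>+t. ennreal (real n * s ^ k) * indicator {0..t} s \<partial>\<mu>) = (\<integral>\<^sup>+t. 0 \<partial>\<mu>)"
          by (intro nn_integral_cong) (use S in \<open>auto simp: indicator_def\<close>)
        then show ?thesis by simp
      qed
    qed
    also have "\<dots> = ennreal (C * (1 ^ n - real n * 1 ^ Suc n / real (Suc n)) - C * (0 ^ n - real n * 0 ^ Suc n / real (Suc n)))"
    proof (rule nn_integral_FTC_Icc)
      fix s :: real assume s: "s \<in> {0..1}"
      have "((\<lambda>s. s ^ Suc n / real (Suc n)) has_real_derivative s ^ n) (at s)"
        by (rule DERIV_cong[OF DERIV_cdivide[OF DERIV_pow]]) (simp del: of_nat_Suc)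
      then have "((\<lambda>s. C * (s ^ n - real n * (s ^ Suc n / real (Suc n)))) has_real_derivative C * (real n * s ^ (n - Suc 0) - real n * s ^ n)) (at s)"
        by (intro DERIV_cmult DERIV_diff DERIV_pow)
      then show "((\<lambda>s. C * (s ^ n - real n * s ^ Suc n / real (Suc n))) has_real_derivative C * (real n * s ^ k * (1 - s))) (at s)"
        using Suc by (simp add: algebra_simps)
      show "0 \<le> C * (real n * s ^ k * (1 - s))" using s C0 by simp
    qed auto
    also have "\<dots> = ennreal (C / real (Suc n))"
      using Suc by (simp add: field_simps)
    finally have "(\<integral>\<^sup>+t. ennreal (t ^ n) \<partial>\<mu>) \<le> ennreal (C / real (Suc n))" .
    then show ?thesis
      unfolding moment_def using C0
      by (intro integral_real_bounded) auto
  qed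
qed

context
  fixes \<mu> :: "real measure" and C :: real
  assumes \<mu>: "borel_measure_01 \<mu>" and C: "0 < C"
    and tail: "\<And>t. 0 \<le> t \<Longrightarrow> t < 1 \<Longrightarrow> measure \<mu> {t..<1} \<le> C * (1 - t)"
begin

text \<open>Expanding the square produces the moments of order \<open>i + j\<close>. They are at
  most \<open>C / (i + j + 1)\<close>, and since the coefficients are nonnegative the resulting form
  is the one in Hilbert's inequality.\<close>

lemma nn_integral_square_le:
  assumes "\<And>n. 0 \<le> x n"
  shows "(\<integral>\<^sup>+t. ennreal ((\<Sum>n<N. x n * t ^ n)\<^sup>2) \<partial>\<mu>) \<le> ennreal (4 * C * (\<Sum>n<N. (x n)\<^sup>2))"
proof -
  interpret finite_measure \<mu> using \<mu> unfolding borel_measure_01_def by simp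
  have It: "integrable \<mu> (\<lambda>t. t ^ k :: real)" for k
    by (rule Bochner_Integration.integrable_bound[of _ "\<lambda>_. 1::real"])
       (auto intro!: borel_measurable_01_continuous[OF \<mu>] continuous_intros AE_I2 simp: space_borel_measure_01[OF \<mu>] power_le_one)
  have sq: "(\<Sum>n<N. x n * t ^ n)\<^sup>2 = (\<Sum>i<N. \<Sum>j<N. x i * x j * t ^ (i + j))" for t
    unfolding power2_eq_square sum_product by (simp add: power_add mult_ac)
  have int: "integrable \<mu> (\<lambda>t. (\<Sum>n<N. x n * t ^ n)\<^sup>2)"
    unfolding sq by (intro Bochner_Integration.integrable_sum integrable_mult_right It)
  have "(\<integral>t. (\<Sum>n<N. x n * t ^ n)\<^sup>2 \<partial>\<mu>) = (\<Sum>i<N. \<Sum>j<N. x i * x j * moment \<mu> (i + j))"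
    unfolding sq moment_def using It
    by (subst Bochner_Integration.integral_sum; (intro Bochner_Integration.integrable_sum integrable_mult_right It)?)
       (simp add: Bochner_Integration.integral_sum)
  also have "\<dots> \<le> (\<Sum>i<N. \<Sum>j<N. x i * x j * (C / real (Suc (i + j))))"
    using assms by (intro sum_mono mult_left_mono moment_le_of_tail_bound[OF \<mu> tail]) auto
  also have "\<dots> = C * (\<Sum>i<N. \<Sum>j<N. x i * x j / real (Suc (i + j)))"
    by (simp add: sum_distrib_left mult_ac)
  also have "\<dots> \<le> C * (4 * (\<Sum>n<N. (x n)\<^sup>2))"
    using C by (intro mult_left_mono Hilbert_inequality) auto
  finally have "(\<integral>t. (\<Sum>n<N. x n * t ^ n)\<^sup>2 \<partial>\<mu>) \<le> 4 * C * (\<Sum>n<N. (x n)\<^sup>2)" by (simp add: mult_ac)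
  then show ?thesis
    by (subst nn_integral_eq_integral[OF int]) (auto intro: ennreal_leI)
qed

text \<open>The majorant is the square of the series with coefficients \<open>x n\<close>.
  Nonnegative coefficients make it increase in \<open>t\<close>, so its value at \<open>t\<close>
  bounds \<open>p\<close> on all of [0,t]. Its integral is controlled through the truncated series
  and monotone convergence.\<close>

lemma poly_radial_majorant:
  fixes p :: "complex poly"
  obtains h :: "real \<Rightarrow> ennreal" where "h \<in> borel_measurable \<mu>"
    "\<And>s t. 0 \<le> s \<Longrightarrow> s \<le> t \<Longrightarrow> t < 1 \<Longrightarrow> ennreal (norm (poly p (of_real s))) \<le> h t"
    "(\<integral>\<^sup>+t. h t \<partial>\<mu>) \<le> ennreal (4 * C * (1 / (2 * pi) * integral {0..2 * pi} (\<lambda>\<theta>. norm (poly p (cis \<theta>)))))"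
proof -
  obtain x :: "nat \<Rightarrow> real" where x: "\<And>n. 0 \<le> x n"
    "\<And>N. (\<Sum>n<N. (x n)\<^sup>2) \<le> 1 / (2 * pi) * integral {0..2 * pi} (\<lambda>\<theta>. norm (poly p (cis \<theta>)))"
    "\<And>s. 0 \<le> s \<Longrightarrow> s < 1 \<Longrightarrow> summable (\<lambda>n. x n * s ^ n)"
    "\<And>s. 0 \<le> s \<Longrightarrow> s < 1 \<Longrightarrow> norm (poly p (of_real s)) \<le> (\<Sum>n. x n * s ^ n)\<^sup>2"
    using poly_square_majorant[of p] by blast
  \<comment> \<open>\<open>max 0 t\<close> makes the truncations increase in \<open>N\<close> at
    every real \<open>t\<close>, as monotone convergence for functions on the whole line demands; on
    the space of \<open>\<mu>\<close> it equals \<open>t\<close>.\<close>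
  define H where "H N t = ennreal ((\<Sum>n<N. x n * max 0 t ^ n)\<^sup>2)" for N t
  have meas: "H N \<in> borel_measurable \<mu>" for N
    unfolding H_def by (intro measurable_compose[OF borel_measurable_01_continuous[OF \<mu>] measurable_ennreal] continuous_intros)
  have inc: "incseq H"
    unfolding H_def using x(1) by (intro incseq_SucI le_funI ennreal_leI power_mono sum_nonneg) auto
  show ?thesis
  proof (rule that[of "\<lambda>t. SUP N. H N t"])
    show "(\<lambda>t. SUP N. H N t) \<in> borel_measurable \<mu>" using meas by measurable
    show "ennreal (norm (poly p (of_real s))) \<le> (SUP N. H N t)" if st: "0 \<le> s" "s \<le> t" "t < 1" for s t
    proof -
      have t0: "0 \<le> t" using st by simp
      have "(\<Sum>n. x n * s ^ n)\<^sup>2 \<le> (\<Sum>n. x n * t ^ n)\<^sup>2"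
        using st x(1) by (intro power_mono suminf_le suminf_nonneg x(3) mult_left_mono) auto
      then have "ennreal (norm (poly p (of_real s))) \<le> ennreal ((\<Sum>n. x n * t ^ n)\<^sup>2)"
        using x(4)[of s] st by (intro ennreal_leI) auto
      also have "\<dots> \<le> (SUP N. H N t)"
      proof (rule LIMSEQ_le_const2)
        show "(\<lambda>N. ennreal ((\<Sum>n<N. x n * t ^ n)\<^sup>2)) \<longlonglongrightarrow> ennreal ((\<Sum>n. x n * t ^ n)\<^sup>2)"
          by (intro tendsto_ennrealI tendsto_power summable_LIMSEQ x(3) t0 st)
        show "\<exists>N. \<forall>n\<ge>N. ennreal ((\<Sum>n<n. x n * t ^ n)\<^sup>2) \<le> (SUP N. H N t)"
          using t0 by (auto simp: H_def max_def intro!: SUP_upper2)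
      qed
      finally show ?thesis .
    qed
    have "(\<integral>\<^sup>+t. (SUP N. H N t) \<partial>\<mu>) = (SUP N. \<integral>\<^sup>+t. H N t \<partial>\<mu>)"
      by (rule nn_integral_monotone_convergence_SUP[OF inc meas])
    also have "\<dots> \<le> ennreal (4 * C * (1 / (2 * pi) * integral {0..2 * pi} (\<lambda>\<theta>. norm (poly p (cis \<theta>)))))"
    proof (rule SUP_least)
      fix N
      have "(\<integral>\<^sup>+t. H N t \<partial>\<mu>) = (\<integral>\<^sup>+t. ennreal ((\<Sum>n<N. x n * t ^ n)\<^sup>2) \<partial>\<mu>)"
        by (intro nn_integral_cong) (auto simp: H_def space_borel_measure_01[OF \<mu>] max_def)
      also have "\<dots> \<le> ennreal (4 * C * (\<Sum>n<N. (x n)\<^sup>2))" by (rule nn_integral_square_le[OF x(1)])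
      also have "\<dots> \<le> ennreal (4 * C * (1 / (2 * pi) * integral {0..2 * pi} (\<lambda>\<theta>. norm (poly p (cis \<theta>)))))"
        using C x(2) by (intro ennreal_leI mult_left_mono) auto
      finally show "(\<integral>\<^sup>+t. H N t \<partial>\<mu>) \<le> \<dots>" .
    qed
    finally show "(\<integral>\<^sup>+t. (SUP N. H N t) \<partial>\<mu>) \<le> ennreal (4 * C * (1 / (2 * pi) * integral {0..2 * pi} (\<lambda>\<theta>. norm (poly p (cis \<theta>)))))" .
  qed
qed

end

section \<open>Integral means, polynomial approximation and the majorant for the Hardy space\<close>

lemma H1_mean_eq:
  assumes "continuous_on (ball 0 1) f" "0 \<le> \<rho>" "\<rho> < 1"
  shows "H1_mean f \<rho> = 1 / (2 * pi) * integral {0..2 * pi} (\<lambda>\<theta>. norm (f (of_real \<rho> * cis \<theta>)))"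
    and "(\<lambda>\<theta>. norm (f (of_real \<rho> * cis \<theta>))) integrable_on {0..2 * pi}"
proof -
  have "continuous_on {0..2 * pi} (\<lambda>\<theta>. norm (f (of_real \<rho> * cis \<theta>)))"
    using assms(2,3) by (intro continuous_on_norm continuous_on_compose2[OF assms(1)] continuous_intros)
      (auto simp: norm_mult)
  from set_borel_integral_eq_integral[OF borel_integrable_atLeastAtMost'[OF this]]
  show "H1_mean f \<rho> = 1 / (2 * pi) * integral {0..2 * pi} (\<lambda>\<theta>. norm (f (of_real \<rho> * cis \<theta>)))"
    "(\<lambda>\<theta>. norm (f (of_real \<rho> * cis \<theta>))) integrable_on {0..2 * pi}"
    unfolding H1_mean_def by auto
qed

lemma H1_continuous_on: "f \<in> H1 \<Longrightarrow> continuous_on (ball 0 1) f"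
  unfolding H1_def by (auto intro: holomorphic_on_imp_continuous_on)

lemma H1_mean_le_norm: "f \<in> H1 \<Longrightarrow> 0 < \<rho> \<Longrightarrow> \<rho> < 1 \<Longrightarrow> H1_mean f \<rho> \<le> H1_norm f"
  unfolding H1_norm_def H1_def by (auto intro!: cSUP_upper)

lemma H1_diff:
  assumes f: "f \<in> H1" and h: "h \<in> H1"
  shows "(\<lambda>z. f z - h z) \<in> H1"
proof -
  have hol: "(\<lambda>z. f z - h z) holomorphic_on ball 0 1"
    using f h unfolding H1_def by (auto intro!: holomorphic_intros)
  have "H1_mean (\<lambda>z. f z - h z) \<rho> \<le> H1_norm f + H1_norm h" if \<rho>: "0 < \<rho>" "\<rho> < 1" for \<rho>
  proof -
    note eqf = H1_mean_eq[OF H1_continuous_on[OF f], of \<rho>] and eqh = H1_mean_eq[OF H1_continuous_on[OF h], of \<rho>]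
    note eqd = H1_mean_eq[OF holomorphic_on_imp_continuous_on[OF hol], of \<rho>]
    have "integral {0..2 * pi} (\<lambda>\<theta>. norm (f (of_real \<rho> * cis \<theta>) - h (of_real \<rho> * cis \<theta>))) \<le>
      integral {0..2 * pi} (\<lambda>\<theta>. norm (f (of_real \<rho> * cis \<theta>)) + norm (h (of_real \<rho> * cis \<theta>)))"
      using eqf eqh eqd \<rho> by (intro integral_le integrable_add norm_triangle_ineq4) auto
    also have "\<dots> = integral {0..2 * pi} (\<lambda>\<theta>. norm (f (of_real \<rho> * cis \<theta>))) + integral {0..2 * pi} (\<lambda>\<theta>. norm (h (of_real \<rho> * cis \<theta>)))"
      using eqf eqh \<rho> by (intro integral_add) auto
    finally have "1 / (2 * pi) * integral {0..2 * pi} (\<lambda>\<theta>. norm (f (of_real \<rho> * cis \<theta>) - h (of_real \<rho> * cis \<theta>))) \<le>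
      1 / (2 * pi) * (integral {0..2 * pi} (\<lambda>\<theta>. norm (f (of_real \<rho> * cis \<theta>))) + integral {0..2 * pi} (\<lambda>\<theta>. norm (h (of_real \<rho> * cis \<theta>))))"
      by (intro mult_left_mono) auto
    then have "H1_mean (\<lambda>z. f z - h z) \<rho> \<le> H1_mean f \<rho> + H1_mean h \<rho>"
      using eqf(1) eqh(1) eqd(1) \<rho> by (simp add: distrib_left)
    then show ?thesis using H1_mean_le_norm[OF f \<rho>] H1_mean_le_norm[OF h \<rho>] by linarith
  qed
  then show ?thesis using hol unfolding H1_def by (auto intro!: bdd_aboveI2[where M = "H1_norm f + H1_norm h"])
qed

text \<open>After dilation by \<open>R < 1\<close> the Taylor coefficients are absolutely summable,
  so the Taylor polynomials converge uniformly on the closed disc, including the circle on which the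
  means are taken.\<close>

lemma dilation_poly_approx:
  assumes hol: "f holomorphic_on ball 0 1" and R: "0 < R" "R < 1" and e: "0 < e"
  obtains p :: "complex poly" where "\<And>z. norm z \<le> 1 \<Longrightarrow> norm (poly p z - f (of_real R * z)) \<le> e"
proof -
  define a where "a n = tcoeff f n * of_real R ^ n" for n
  have sm: "summable (\<lambda>n. norm (a n))"
    using tcoeff_abs_summable[OF hol, of R] R by (simp add: a_def norm_mult norm_power)
  have "uniform_limit (cball 0 1) (\<lambda>M z. \<Sum>n<M. a n * z ^ n) (\<lambda>z. \<Sum>n. a n * z ^ n) sequentially"
    by (rule Weierstrass_m_test[OF _ sm]) (simp add: norm_mult norm_power mult_left_le power_le_one)
  then obtain M where M: "\<And>z. norm z \<le> 1 \<Longrightarrow> dist (\<Sum>n<M. a n * z ^ n) (\<Sum>n. a n * z ^ n) < e"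
    unfolding uniform_limit_sequentially_iff using e by (metis dist_0_norm mem_cball order_refl)
  show ?thesis
  proof (rule that[of "\<Sum>n<M. monom (a n) n"])
    fix z :: complex assume z: "norm z \<le> 1"
    have "norm (of_real R * z) = R * norm z" using R by (simp add: norm_mult)
    also have "\<dots> \<le> R * 1" using z R by (intro mult_left_mono) auto
    also have "\<dots> < 1" using R by simp
    finally have "(\<Sum>n. a n * z ^ n) = f (of_real R * z)"
      using tcoeff_sums[OF hol, of "of_real R * z"] by (simp add: sums_iff a_def power_mult_distrib mult_ac)
    then show "norm (poly (\<Sum>n<M. monom (a n) n) z - f (of_real R * z)) \<le> e"
      using M[OF z] by (simp add: poly_sum poly_monom dist_norm)
  qed
qed

text \<open>Dilations of \<open>f\<close> with radii tending to 1 are approximated by polynomials,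
  whose means on the circle exceed the norm of \<open>f\<close> by at most
  \<open>1 / (k + 1)\<close>. The lower limit of their majorants dominates \<open>f\<close>, by
  pointwise convergence, and Fatou's lemma preserves the bound on the integral.\<close>

lemma H1_radially_dominated:
  assumes \<mu>: "borel_measure_01 \<mu>" and C: "0 < C"
    and tail: "\<And>t. 0 \<le> t \<Longrightarrow> t < 1 \<Longrightarrow> measure \<mu> {t..<1} \<le> C * (1 - t)" and f: "f \<in> H1"
  shows "\<exists>g. radially_dominated \<mu> f g \<and> (\<integral>t. g t \<partial>\<mu>) \<le> 4 * C * H1_norm f"
proof -
  have hol: "f holomorphic_on ball 0 1" using f unfolding H1_def by simp
  note cont = H1_continuous_on[OF f]
  \<comment> \<open>The shift by two keeps every radius strictly between 0 and 1, starting at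
    1/2.\<close>
  define R where "R k = 1 - 1 / real (Suc (Suc k))" for k
  have R: "0 < R k" "R k < 1" for k by (auto simp: R_def field_simps)
  have R1: "R \<longlonglongrightarrow> 1"
  proof -
    have "(\<lambda>k. 1 / real (Suc (Suc k))) \<longlonglongrightarrow> 0"
      using LIMSEQ_Suc[OF LIMSEQ_Suc[OF lim_1_over_n]] by simp
    from tendsto_diff[OF tendsto_const[of 1] this] show ?thesis by (simp add: R_def[abs_def])
  qed
  have "\<exists>p. \<forall>z. norm z \<le> 1 \<longrightarrow> norm (poly p z - f (of_real (R k) * z)) \<le> 1 / real (Suc k)" for k
    using dilation_poly_approx[OF hol R, of "1 / real (Suc k)" k] by (metis of_nat_0_less_iff zero_less_Suc zero_less_divide_1_iff)
  then obtain p where p: "\<And>k z. norm z \<le> 1 \<Longrightarrow> norm (poly (p k) z - f (of_real (R k) * z)) \<le> 1 / real (Suc k)"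
    by metis
  have mean: "1 / (2 * pi) * integral {0..2 * pi} (\<lambda>\<theta>. norm (poly (p k) (cis \<theta>))) \<le> H1_norm f + 1 / real (Suc k)" for k
  proof -
    note eq = H1_mean_eq[OF cont less_imp_le[OF R(1)] R(2), of k]
    have "integral {0..2 * pi} (\<lambda>\<theta>. norm (poly (p k) (cis \<theta>))) \<le> integral {0..2 * pi} (\<lambda>\<theta>. norm (f (of_real (R k) * cis \<theta>)) + 1 / real (Suc k))"
    proof (rule integral_le)
      show "(\<lambda>\<theta>. norm (poly (p k) (cis \<theta>))) integrable_on {0..2 * pi}"
        by (intro integrable_continuous_real continuous_intros)
      show "(\<lambda>\<theta>. norm (f (of_real (R k) * cis \<theta>)) + 1 / real (Suc k)) integrable_on {0..2 * pi}"
        by (intro integrable_add eq(2)) auto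
      show "norm (poly (p k) (cis \<theta>)) \<le> norm (f (of_real (R k) * cis \<theta>)) + 1 / real (Suc k)" for \<theta>
        using p[of "cis \<theta>" k] norm_triangle_sub[of "poly (p k) (cis \<theta>)" "f (of_real (R k) * cis \<theta>)"] by simp
    qed
    also have "\<dots> = integral {0..2 * pi} (\<lambda>\<theta>. norm (f (of_real (R k) * cis \<theta>))) + 2 * pi * (1 / real (Suc k))"
      by (subst integral_add[OF eq(2)]) auto
    finally have "1 / (2 * pi) * integral {0..2 * pi} (\<lambda>\<theta>. norm (poly (p k) (cis \<theta>))) \<le>
        1 / (2 * pi) * (integral {0..2 * pi} (\<lambda>\<theta>. norm (f (of_real (R k) * cis \<theta>))) + 2 * pi * (1 / real (Suc k)))"
      by (intro mult_left_mono) auto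
    also have "\<dots> = H1_mean f (R k) + 1 / real (Suc k)"
      unfolding eq(1) distrib_left by simp
    also have "\<dots> \<le> H1_norm f + 1 / real (Suc k)" using H1_mean_le_norm[OF f R] by simp
    finally show ?thesis .
  qed
  have "\<exists>h. h \<in> borel_measurable \<mu> \<and> (\<forall>s t. 0 \<le> s \<longrightarrow> s \<le> t \<longrightarrow> t < 1 \<longrightarrow> ennreal (norm (poly (p k) (of_real s))) \<le> h t) \<and>
      (\<integral>\<^sup>+t. h t \<partial>\<mu>) \<le> ennreal (4 * C * (H1_norm f + 1 / real (Suc k)))" for k
  proof -
    obtain h where h: "h \<in> borel_measurable \<mu>"
      "\<And>s t. 0 \<le> s \<Longrightarrow> s \<le> t \<Longrightarrow> t < 1 \<Longrightarrow> ennreal (norm (poly (p k) (of_real s))) \<le> h t"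
      "(\<integral>\<^sup>+t. h t \<partial>\<mu>) \<le> ennreal (4 * C * (1 / (2 * pi) * integral {0..2 * pi} (\<lambda>\<theta>. norm (poly (p k) (cis \<theta>)))))"
      using poly_radial_majorant[OF \<mu> C tail, of "p k"] by metis
    note h(3)
    also have "ennreal (4 * C * (1 / (2 * pi) * integral {0..2 * pi} (\<lambda>\<theta>. norm (poly (p k) (cis \<theta>))))) \<le>
      ennreal (4 * C * (H1_norm f + 1 / real (Suc k)))"
      using C by (intro ennreal_leI mult_left_mono mean) auto
    finally show ?thesis using h(1,2) by blast
  qed
  then obtain h where h[measurable]: "\<And>k. h k \<in> borel_measurable \<mu>"
    and hp: "\<And>k s t. 0 \<le> s \<Longrightarrow> s \<le> t \<Longrightarrow> t < 1 \<Longrightarrow> ennreal (norm (poly (p k) (of_real s))) \<le> h k t"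
    and hi: "\<And>k. (\<integral>\<^sup>+t. h k t \<partial>\<mu>) \<le> ennreal (4 * C * (H1_norm f + 1 / real (Suc k)))"
    by metis
  define G where "G t = liminf (\<lambda>k. h k t)" for t
  have G[measurable]: "G \<in> borel_measurable \<mu>" unfolding G_def by measurable
  have Gi: "(\<integral>\<^sup>+t. G t \<partial>\<mu>) \<le> ennreal (4 * C * H1_norm f)"
  proof -
    have "(\<integral>\<^sup>+t. G t \<partial>\<mu>) \<le> liminf (\<lambda>k. \<integral>\<^sup>+t. h k t \<partial>\<mu>)"
      unfolding G_def by (rule nn_integral_liminf) simp
    also have "\<dots> \<le> liminf (\<lambda>k. ennreal (4 * C * (H1_norm f + 1 / real (Suc k))))"
      by (intro Liminf_mono always_eventually allI hi)
    also have "\<dots> = ennreal (4 * C * (H1_norm f + 0))"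
      by (intro lim_imp_Liminf tendsto_ennrealI tendsto_intros LIMSEQ_Suc[OF lim_1_over_n]) simp
    finally show ?thesis by simp
  qed
  have fG: "ennreal (norm (f (of_real s))) \<le> G t" if st: "0 \<le> s" "s \<le> t" "t < 1" for s t
  proof -
    have ns: "norm (complex_of_real s) \<le> 1" using st by simp
    have "(\<lambda>k. f (of_real (R k) * of_real s)) \<longlonglongrightarrow> f (of_real s)"
    proof (rule isCont_tendsto_compose[where g = f])
      show "isCont f (of_real s)"
        using cont st by (auto intro!: continuous_on_interior simp: interior_open)
      have "(\<lambda>k. complex_of_real (R k) * of_real s) \<longlonglongrightarrow> of_real 1 * of_real s"
        by (intro tendsto_intros R1)
      then show "(\<lambda>k. complex_of_real (R k) * of_real s) \<longlonglongrightarrow> of_real s" by simp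
    qed
    moreover have "(\<lambda>k. poly (p k) (of_real s) - f (of_real (R k) * of_real s)) \<longlonglongrightarrow> 0"
      by (rule Lim_null_comparison[OF always_eventually LIMSEQ_Suc[OF lim_1_over_n]]) (use p[OF ns] in auto)
    ultimately have "(\<lambda>k. (poly (p k) (of_real s) - f (of_real (R k) * of_real s)) + f (of_real (R k) * of_real s)) \<longlonglongrightarrow> 0 + f (of_real s)"
      by (intro tendsto_add)
    then have "(\<lambda>k. ennreal (norm (poly (p k) (of_real s)))) \<longlonglongrightarrow> ennreal (norm (f (of_real s)))"
      by (intro tendsto_ennrealI tendsto_norm) simp
    then have "ennreal (norm (f (of_real s))) = liminf (\<lambda>k. ennreal (norm (poly (p k) (of_real s))))"
      using lim_imp_Liminf[OF sequentially_bot] by metis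
    also have "\<dots> \<le> G t" unfolding G_def using hp st by (intro Liminf_mono always_eventually allI) auto
    finally show ?thesis .
  qed
  have n0: "0 \<le> H1_norm f"
  proof -
    have "0 \<le> H1_mean f (1 / 2)" unfolding H1_mean_def set_lebesgue_integral_def by (intro mult_nonneg_nonneg integral_nonneg_AE) auto
    also have "\<dots> \<le> H1_norm f" by (rule H1_mean_le_norm[OF f]) auto
    finally show ?thesis .
  qed
  have fin: "AE t in \<mu>. G t \<noteq> \<infinity>"
    using Gi by (intro nn_integral_PInf_AE G) (auto simp: top_unique)
  \<comment> \<open>\<open>enn2real\<close> sends infinity to 0, so \<open>g\<close> dominates only
    off the null set where \<open>G\<close> is infinite.\<close>
  define g where "g t = enn2real (G t)" for t
  have gm[measurable]: "g \<in> borel_measurable \<mu>" unfolding g_def by measurable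
  have gi: "(\<integral>\<^sup>+t. ennreal (g t) \<partial>\<mu>) \<le> ennreal (4 * C * H1_norm f)"
  proof -
    have "(\<integral>\<^sup>+t. ennreal (g t) \<partial>\<mu>) \<le> (\<integral>\<^sup>+t. G t \<partial>\<mu>)"
      unfolding g_def by (intro nn_integral_mono) (metis enn2real_top ennreal_0 ennreal_enn2real_if order_refl zero_le)
    then show ?thesis using Gi by (rule order_trans)
  qed
  have "radially_dominated \<mu> f g"
    unfolding radially_dominated_def
  proof (intro conjI hol)
    show "integrable \<mu> g"
      by (rule integrableI_nonneg) (use gi in \<open>auto simp: g_def less_top[symmetric] top_unique\<close>)
    show "AE t in \<mu>. \<forall>r\<in>{0..1}. norm (f (complex_of_real (r * t))) \<le> g t"
      using fin AE_space
    proof eventually_elim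
      case (elim t)
      have t: "0 \<le> t" "t < 1" using elim(2) space_borel_measure_01[OF \<mu>] by auto
      show ?case
      proof
        fix r :: real assume r: "r \<in> {0..1}"
        then have "0 \<le> r * t" "r * t \<le> t" using t mult_left_le_one_le[of t r] by auto
        then have "ennreal (norm (f (complex_of_real (r * t)))) \<le> G t" using t by (intro fG) auto
        also have "G t = ennreal (g t)" using elim(1) by (simp add: g_def less_top)
        finally show "norm (f (complex_of_real (r * t))) \<le> g t" by (simp add: g_def)
      qed
    qed
  qed
  moreover have "(\<integral>t. g t \<partial>\<mu>) \<le> 4 * C * H1_norm f"
    using n0 C gi by (intro integral_real_bounded) auto
  ultimately show ?thesis by blast
qed

lemma Imu_good_H1:
  assumes \<mu>: "borel_measure_01 \<mu>" and "carleson \<mu>"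
  shows "Imu_good \<mu> H1 H1_norm"
proof -
  obtain C where C: "0 < C" "\<And>t. 0 \<le> t \<Longrightarrow> t < 1 \<Longrightarrow> measure \<mu> {t..<1} \<le> C * (1 - t)"
    using carleson_tail_bound[OF assms] by blast
  show ?thesis
    by (rule Imu_good_of_domination[OF \<mu> H1_radially_dominated[OF \<mu> C] H1_diff])
qed

section \<open>Monomials touching the inverse weight\<close>

text \<open>\<open>u\<close> is the radial profile of the weight, and \<open>A n\<close> is the
  reciprocal of the maximum of \<open>t ^ n * u t\<close>, attained at \<open>r n\<close>. In
  logarithmic coordinates the monomials \<open>A n * t ^ n\<close> are the supporting lines of
  integer slope below the graph of \<open>1 / u\<close>.\<close>

locale touching_monomials =
  fixes u :: "real \<Rightarrow> real" and A :: "nat \<Rightarrow> real" and r :: "nat \<Rightarrow> real"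
  assumes u_pos: "0 \<le> t \<Longrightarrow> t < 1 \<Longrightarrow> 0 < u t"
    and u_antimono: "0 \<le> s \<Longrightarrow> s \<le> t \<Longrightarrow> t < 1 \<Longrightarrow> u t \<le> u s"
    and u_lim: "(u \<longlongrightarrow> 0) (at_left 1)"
    and A_pos: "0 < A n"
    and r_nonneg: "0 \<le> r n" and r_less: "r n < 1"
    and below: "0 \<le> t \<Longrightarrow> t < 1 \<Longrightarrow> A n * t ^ n * u t \<le> 1"
    and touch: "A n * r n ^ n * u (r n) = 1"
begin

definition m :: "nat \<Rightarrow> real \<Rightarrow> real" where "m n t = A n * t ^ n"

lemma m_pos: "0 < t \<Longrightarrow> 0 < m n t"
  using A_pos by (simp add: m_def)

lemma m_nonneg: "0 \<le> t \<Longrightarrow> 0 \<le> m n t"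
  using A_pos[of n] by (simp add: m_def)

lemma m_le: "0 \<le> t \<Longrightarrow> t < 1 \<Longrightarrow> m n t \<le> 1 / u t"
  using below[of t n] u_pos[of t] by (simp add: m_def pos_le_divide_eq)

lemma m_touch: "m n (r n) = 1 / u (r n)"
  using touch[of n] u_pos[OF r_nonneg r_less, of n] by (simp add: m_def field_simps)

lemma m_touch_max: "m k (r n) \<le> m n (r n)"
  using m_le[OF r_nonneg r_less] m_touch by simp

lemma r_pos: "n > 0 \<Longrightarrow> 0 < r n"
  using touch[of n] r_nonneg[of n] by (cases "r n = 0") (auto simp: power_0_left)

text \<open>The quotient of \<open>m k\<close> by \<open>m n\<close> is a constant times
  \<open>t ^ (k - n)\<close>, hence increasing in \<open>t\<close>; the cross-multiplied form avoids
  dividing by values that may vanish at 0.\<close>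

lemma m_cross:
  assumes "n \<le> k" "0 \<le> s" "s \<le> t"
  shows "m k s * m n t \<le> m n s * m k t"
proof -
  have "s ^ (k - n) \<le> t ^ (k - n)" using assms by (intro power_mono) auto
  then have "(A k * A n * s ^ n * t ^ n) * s ^ (k - n) \<le> (A k * A n * s ^ n * t ^ n) * t ^ (k - n)"
    using assms A_pos[of k] A_pos[of n] by (intro mult_left_mono) auto
  moreover have "s ^ k = s ^ n * s ^ (k - n)" "t ^ k = t ^ n * t ^ (k - n)"
    using assms by (simp_all flip: power_add)
  ultimately show ?thesis by (simp add: m_def mult_ac)
qed

lemma m_scale: "0 < s \<Longrightarrow> m n t = m n s * (t / s) ^ n"
  by (simp add: m_def power_divide)

text \<open>If the contact radii were in the wrong order, strict growth of the quotient of
  \<open>m k\<close> by \<open>m n\<close> would contradict that each monomial is the largest one at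
  its own contact radius.\<close>

lemma r_mono: "n \<le> k \<Longrightarrow> r n \<le> r k"
proof (rule ccontr)
  assume "n \<le> k" and "\<not> r n \<le> r k"
  then have nk: "n < k" and lt: "r k < r n" by (auto simp: le_less)
  have pos: "0 < r k" "0 < r n" using nk lt r_pos[of k] by auto
  have "r k ^ (k - n) < r n ^ (k - n)" using nk lt pos by (intro power_strict_mono) auto
  then have "(A k * A n * r k ^ n * r n ^ n) * r k ^ (k - n) < (A k * A n * r k ^ n * r n ^ n) * r n ^ (k - n)"
    using pos A_pos[of k] A_pos[of n] by (intro mult_strict_left_mono) auto
  moreover have "r k ^ k = r k ^ n * r k ^ (k - n)" "r n ^ k = r n ^ n * r n ^ (k - n)"
    using nk by (simp_all flip: power_add)
  ultimately have "m k (r k) * m n (r n) < m n (r k) * m k (r n)" by (simp add: m_def mult_ac)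
  moreover have "m n (r k) * m k (r n) \<le> m k (r k) * m n (r n)"
    using pos by (intro mult_mono m_touch_max) (auto intro: m_nonneg)
  ultimately show False by simp
qed

text \<open>If all contact radii stayed at or below \<open>t\<close>, then at a point
  \<open>t'\<close> between \<open>t\<close> and 1 the monomials would be at least
  \<open>1 / u 0\<close> times \<open>(t' / t) ^ n\<close>, which is unbounded, although they never
  exceed \<open>1 / u t'\<close>.\<close>

lemma r_exceeds: "t < 1 \<Longrightarrow> \<exists>N. t < r N"
proof (rule ccontr)
  assume t: "t < 1" and "\<nexists>N. t < r N"
  then have le: "r n \<le> t" for n by (meson not_le)
  have t0: "0 < t" using le[of 1] r_pos[of 1] by simp
  define t' where "t' = (1 + t) / 2"
  have t': "t < t'" "t' < 1" using t by (auto simp: t'_def)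
  obtain n where n: "u 0 / u t' < (t' / t) ^ n" using real_arch_pow[of "t' / t"] t0 t' by auto
  have n1: "(t' / t) ^ n \<le> (t' / t) ^ Suc n" using t0 t' by (intro power_increasing) auto
  let ?n = "Suc n"
  have rp: "0 < r ?n" by (rule r_pos) simp
  have "1 / u 0 * (t' / t) ^ ?n \<le> m ?n (r ?n) * (t' / r ?n) ^ ?n"
    unfolding m_touch using le[of ?n] rp t0 t' u_pos[of 0] u_pos[of "r ?n"] r_less[of ?n] u_antimono[of 0 "r ?n"]
    by (intro mult_mono power_mono frac_le) auto
  also have "\<dots> = m ?n t'" by (rule m_scale[OF rp, symmetric])
  also have "\<dots> \<le> 1 / u t'" using t0 t' by (intro m_le) auto
  finally have "u 0 * (1 / u 0 * (t' / t) ^ ?n) \<le> u 0 * (1 / u t')"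
    using u_pos[of 0] by (intro mult_left_mono) auto
  then have "(t' / t) ^ ?n \<le> u 0 / u t'"
    using u_pos[of 0] by (simp del: power_Suc)
  then show False using n n1 by linarith
qed

text \<open>The maximum principle on the annulus between two touching radii takes the place of
  Hadamard's three circles theorem.\<close>

lemma holomorphic_le_touching_monomials:
  assumes hol: "f holomorphic_on ball 0 1" and f: "\<And>z. norm z < 1 \<Longrightarrow> norm (f z) * u (norm z) \<le> 1"
    and t: "r 1 \<le> t" "t < 1"
  shows "\<exists>N. norm (f (of_real t)) \<le> (m N t + m (Suc N) t) / r 1"
proof -
  \<comment> \<open>The first contact radius beyond \<open>t\<close> belongs to an index
    \<open>N + 1\<close>, so \<open>t\<close> lies between the contact radii of \<open>N\<close> and
    \<open>N + 1\<close>.\<close>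
  define M where "M = (LEAST n. t < r n)"
  have M: "t < r M" unfolding M_def using r_exceeds[OF t(2)] by (rule LeastI_ex)
  have less: "r n \<le> t" if "n < M" for n using not_less_Least[of n "\<lambda>n. t < r n"] that unfolding M_def by auto
  have "M > 1" using M t r_mono[of M 1] by (cases "M > 1") auto
  then obtain N where N: "M = Suc N" "N > 0" by (cases M) auto
  let ?R = "r (Suc N)"
  have rN: "0 < r N" "r N \<le> t" "t < ?R" "?R < 1" using less[of N] M N r_pos r_less by auto
  have r1: "0 < r 1" by (rule r_pos) simp
  have t0: "0 < t" using r1 t by simp
  define S where "S = {z::complex. r N \<le> norm z \<and> norm z \<le> ?R}"
  \<comment> \<open>\<open>A N\<close> bounds \<open>f z / z ^ N\<close> on the inner circle and
    \<open>A (Suc N) * ?R\<close> on the outer one; the sum serves for both.\<close>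
  define B where "B = A N + A (Suc N) * ?R"
  have fb: "norm (f z) \<le> 1 / u (norm z)" if "norm z < 1" for z
    using f[OF that] u_pos[of "norm z"] that by (simp add: pos_le_divide_eq)
  have clS: "closed S"
    unfolding S_def by (intro closed_Collect_conj closed_Collect_le continuous_intros)
  have sub: "S \<subseteq> ball 0 1" and nz: "z \<noteq> 0" if "z \<in> S" for z using rN that by (auto simp: S_def)
  have holg: "(\<lambda>z. f z / z ^ N) holomorphic_on S"
    using nz rN by (intro holomorphic_intros holomorphic_on_subset[OF hol]) (auto simp: S_def)
  have "norm (f (of_real t) / of_real t ^ N) \<le> B"
  proof (rule maximum_modulus_frontier[of "\<lambda>z. f z / z ^ N" S])
    show "(\<lambda>z. f z / z ^ N) holomorphic_on interior S"
      using holg interior_subset holomorphic_on_subset by blast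
    show "continuous_on (closure S) (\<lambda>z. f z / z ^ N)"
      using holg clS holomorphic_on_imp_continuous_on by simp
    show "bounded S" by (rule bounded_subset[of "cball 0 ?R"]) (auto simp: S_def)
    show "of_real t \<in> S" using rN t0 by (simp add: S_def)
    fix z assume z: "z \<in> frontier S"
    have "open {z::complex. r N < norm z \<and> norm z < ?R}"
      by (intro open_Collect_conj open_Collect_less continuous_intros)
    then have "{z::complex. r N < norm z \<and> norm z < ?R} \<subseteq> interior S"
      by (intro interior_maximal) (auto simp: S_def)
    then have "norm z = r N \<or> norm z = ?R"
      using z frontier_subset_closed[OF clS] unfolding frontier_def S_def by force
    moreover have "norm (f z / z ^ N) \<le> A N" if e: "norm z = r N"
    proof -
      have "norm (f z) \<le> m N (r N)" using fb[of z] e r_less[of N] m_touch[of N] by simp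
      then show ?thesis using e rN by (simp add: norm_divide norm_power m_def pos_divide_le_eq)
    qed
    moreover have "norm (f z / z ^ N) \<le> A (Suc N) * ?R" if e: "norm z = ?R"
    proof -
      have "norm (f z) \<le> m (Suc N) ?R" using fb[of z] e r_less[of "Suc N"] m_touch[of "Suc N"] by simp
      then show ?thesis using e rN by (simp add: norm_divide norm_power m_def pos_divide_le_eq mult_ac)
    qed
    ultimately show "norm (f z / z ^ N) \<le> B"
      using A_pos[of N] A_pos[of "Suc N"] rN unfolding B_def by (smt (verit) mult_pos_pos)
  qed
  then have "norm (f (of_real t)) \<le> B * t ^ N"
    using t0 by (simp add: norm_divide norm_power pos_divide_le_eq)
  also have "B * t ^ N = m N t + A (Suc N) * t ^ N * ?R" by (simp add: B_def m_def algebra_simps)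
  \<comment> \<open>Since \<open>?R < 1\<close> and \<open>r 1 \<le> t\<close>, the radius
    \<open>?R\<close> is at most \<open>t / r 1\<close>. This supplies the missing factor
    \<open>t\<close> of the second monomial at the cost of \<open>1 / r 1\<close>.\<close>
  also have "\<dots> \<le> m N t / r 1 + A (Suc N) * t ^ N * (t / r 1)"
  proof (intro add_mono mult_left_mono)
    have "m N t * r 1 \<le> m N t * 1" using r_less[of 1] m_nonneg[of t N] t0 by (intro mult_left_mono) auto
    then show "m N t \<le> m N t / r 1" using r1 by (simp add: pos_le_divide_eq)
    have "?R * r 1 \<le> 1 * t" using rN t r1 by (intro mult_mono) auto
    then show "?R \<le> t / r 1" using r1 by (simp add: pos_le_divide_eq)
  qed (use A_pos[of "Suc N"] t0 in simp)
  also have "\<dots> = (m N t + m (Suc N) t) / r 1" by (simp add: m_def add_divide_distrib mult_ac)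
  finally show ?thesis by blast
qed

text \<open>Maximal indices \<open>b\<close> with \<open>covers a b\<close> drive the greedy choice; a pair that fails to be covered is
  separated by a factor 2 at both touching radii, which is what makes the chosen series geometric.\<close>

definition covers :: "nat \<Rightarrow> nat \<Rightarrow> bool" where
  "covers a b \<longleftrightarrow> (\<forall>k\<in>{a..b}. \<forall>t\<in>{0<..<1}. m k t \<le> 2 * max (m a t) (m b t))"

text \<open>There is no index strictly between neighbours; this guarantees that the greedy choice
  always advances.\<close>

lemma covers_Suc: "covers a (Suc a)"
  unfolding covers_def
proof (intro ballI)
  fix k t assume "k \<in> {a..Suc a}" "t \<in> {0<..<1::real}"
  then have "k = a \<or> k = Suc a" "0 \<le> m a t" "0 \<le> m (Suc a) t" by (auto intro: m_nonneg)
  then show "m k t \<le> 2 * max (m a t) (m (Suc a) t)" by auto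
qed

text \<open>Some \<open>k\<close> beyond \<open>a\<close> has a contact radius \<open>t\<close> so
  near 1 that \<open>m k t\<close> exceeds twice \<open>m a t\<close>. At this fixed
  \<open>t\<close> the values \<open>m n t\<close> decay geometrically in \<open>n\<close>, so for
  large \<open>n\<close> neither endpoint controls \<open>m k t\<close>. Hence a greatest covered
  index exists.\<close>

lemma covers_bounded: "\<exists>b. \<forall>n. covers a n \<longrightarrow> n \<le> b"
proof -
  have "\<forall>\<^sub>F t in at_left 1. u t < 1 / (2 * A a)"
    using u_lim A_pos[of a] by (intro order_tendstoD(2)) auto
  then obtain t0 where t0: "t0 < 1" "\<And>t. t0 < t \<Longrightarrow> t < 1 \<Longrightarrow> u t < 1 / (2 * A a)"
    by (auto simp: eventually_at_left_field)
  obtain k0 where k0: "t0 < r k0" using r_exceeds[OF t0(1)] by blast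
  define k where "k = max k0 (Suc a)"
  have k: "a < k" "t0 < r k" using k0 r_mono[of k0 k] by (auto simp: k_def)
  define t where "t = r k"
  have t: "0 < t" "t < 1" using k r_pos[of k] r_less[of k] by (auto simp: t_def)
  have big: "2 * m a t < m k t"
  proof -
    have "u t < 1 / (2 * A a)" using t0(2) k t by (simp add: t_def)
    then have "2 * A a < 1 / u t"
      using u_pos[of t] t A_pos[of a] by (simp add: field_simps)
    moreover have "m a t \<le> A a" unfolding m_def using t A_pos[of a] by (simp add: mult_left_le power_le_one)
    ultimately show ?thesis using m_touch[of k] by (simp add: t_def)
  qed
  define t' where "t' = (1 + t) / 2"
  have t': "t < t'" "t' < 1" using t by (auto simp: t'_def)
  have "(\<lambda>n. (1 / u t') * (t / t') ^ n) \<longlonglongrightarrow> (1 / u t') * 0"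
    using t t' by (intro tendsto_intros LIMSEQ_power_zero) auto
  then have "\<forall>\<^sub>F n in sequentially. (1 / u t') * (t / t') ^ n < m k t / 2"
    using m_pos[OF t(1), of k] by (intro order_tendstoD(2)) auto
  then obtain n0 where n0: "\<And>n. n \<ge> n0 \<Longrightarrow> (1 / u t') * (t / t') ^ n < m k t / 2"
    by (auto simp: eventually_sequentially)
  have "\<not> covers a n" if n: "n \<ge> max n0 k" for n
  proof
    assume "covers a n"
    then have "m k t \<le> 2 * max (m a t) (m n t)" using k n t unfolding covers_def by auto
    moreover have "m n t \<le> (1 / u t') * (t / t') ^ n"
      unfolding m_scale[of t' n t, OF less_trans[OF t(1) t'(1)]] using t t' m_le[of t' n]
      by (intro mult_right_mono) auto
    moreover have "(1 / u t') * (t / t') ^ n < m k t / 2" using n by (intro n0) simp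
    ultimately show False using big by linarith
  qed
  then show ?thesis by (metis nat_le_linear)
qed

text \<open>Some \<open>m k\<close> with \<open>k\<close> between \<open>a\<close> and
  \<open>b\<close> exceeds twice both end monomials at a point \<open>t\<close>, and maximality at
  the contact radii forces \<open>r a \<le> t \<le> r b\<close>. As quotients of monomials are
  monotone, the factor 2 over \<open>m a\<close> persists to the right of \<open>t\<close>, while
  \<open>m b\<close> overtakes \<open>m k\<close> beyond \<open>r b\<close>; the other side is
  symmetric.\<close>

lemma not_covers_decay:
  assumes ab: "a \<le> b" and nc: "\<not> covers a b"
  shows "r b \<le> s \<Longrightarrow> s < 1 \<Longrightarrow> 2 * m a s \<le> m b s"
    and "0 < s \<Longrightarrow> s \<le> r a \<Longrightarrow> 2 * m b s \<le> m a s"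
proof -
  obtain k t where k: "a \<le> k" "k \<le> b" and t: "0 < t" "t < 1" and "m k t > 2 * max (m a t) (m b t)"
    using nc unfolding covers_def by (auto simp: not_le)
  then have ka: "2 * m a t < m k t" and kb: "2 * m b t < m k t" by auto
  have mp: "0 < m n t" for n by (rule m_pos[OF t(1)])
  have b0: "0 < b"
  proof (rule ccontr)
    assume "\<not> 0 < b"
    then have "k = a" "b = a" using k by auto
    then show False using ka mp[of a] by auto
  qed
  have rb: "0 < r b" by (rule r_pos[OF b0])
  have tb: "t \<le> r b"
  proof (rule ccontr)
    assume "\<not> t \<le> r b"
    then have "m b (r b) * m k t \<le> m k (r b) * m b t" using m_cross[OF k(2), of "r b" t] rb by simp
    also have "\<dots> \<le> m b (r b) * m b t" using mp[of b] m_touch_max by (intro mult_right_mono) auto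
    finally have "m k t \<le> m b t" using m_pos[OF rb, of b] by simp
    then show False using kb mp[of b] by simp
  qed
  have ta: "r a \<le> t"
  proof (rule ccontr)
    assume *: "\<not> r a \<le> t"
    then have ra: "0 < r a" using t by simp
    have "m k t * m a (r a) \<le> m a t * m k (r a)" using m_cross[OF k(1), of t "r a"] * t by simp
    also have "\<dots> \<le> m a t * m a (r a)" using mp[of a] m_touch_max by (intro mult_left_mono) auto
    finally have "m k t \<le> m a t" using m_pos[OF ra, of a] by simp
    then show False using ka mp[of a] by simp
  qed
  show "2 * m a s \<le> m b s" if s: "r b \<le> s" "s < 1"
  proof -
    have s0: "0 < s" using s rb by simp
    have "m k t * (2 * m a s) \<le> (2 * m a t) * m k s" using m_cross[OF k(1), of t s] t tb s by simp
    also have "\<dots> \<le> m k t * m k s" using ka m_pos[OF s0, of k] by (intro mult_right_mono) auto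
    finally have 1: "2 * m a s \<le> m k s" using mp[of k] by simp
    have "m b (r b) * m k s \<le> m k (r b) * m b s" using m_cross[OF k(2), of "r b" s] s rb by simp
    also have "\<dots> \<le> m b (r b) * m b s" using m_pos[OF s0, of b] m_touch_max by (intro mult_right_mono) auto
    finally show ?thesis using m_pos[OF rb, of b] 1 by simp
  qed
  show "2 * m b s \<le> m a s" if s: "0 < s" "s \<le> r a"
  proof -
    have ra: "0 < r a" using s by simp
    have "m k t * (2 * m b s) \<le> m k s * (2 * m b t)" using m_cross[OF k(2), of s t] ta s by (simp add: mult.commute)
    also have "\<dots> \<le> m k s * m k t" using kb m_pos[OF s(1), of k] by (intro mult_left_mono) auto
    finally have 1: "2 * m b s \<le> m k s" using mp[of k] by simp
    have "m k s * m a (r a) \<le> m a s * m k (r a)" using m_cross[OF k(1), of s "r a"] s by simp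
    also have "\<dots> \<le> m a s * m a (r a)" using m_pos[OF s(1), of a] m_touch_max by (intro mult_left_mono) auto
    finally show ?thesis using m_pos[OF ra, of a] 1 by simp
  qed
qed

text \<open>Each index is followed by the greatest one it covers up to, so the index after the next
  is out of reach. Starting at 0 makes every natural number lie between two consecutive
  choices.\<close>

lemma greedy_indices:
  obtains q :: "nat \<Rightarrow> nat" where "strict_mono q" "q 0 = 0"
    "\<And>i. covers (q i) (q (Suc i))" "\<And>i. \<not> covers (q i) (q (Suc (Suc i)))"
proof -
  define nx where "nx a = (GREATEST n. covers a n)" for a
  have nx: "covers a (nx a)" "covers a n \<Longrightarrow> n \<le> nx a" for a n
  proof -
    obtain b where b: "\<forall>n. covers a n \<longrightarrow> n \<le> b" using covers_bounded by blast
    show "covers a (nx a)" unfolding nx_def using GreatestI_nat[of "covers a" "Suc a" b] covers_Suc b by blast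
    show "covers a n \<Longrightarrow> n \<le> nx a" unfolding nx_def using Greatest_le_nat[of "covers a" n b] b by blast
  qed
  have gt: "a < nx a" for a using nx(2)[OF covers_Suc, of a] by simp
  define q where "q i = (nx ^^ i) 0" for i
  have qS: "q (Suc i) = nx (q i)" for i by (simp add: q_def)
  show ?thesis
  proof (rule that[of q])
    show "strict_mono q" unfolding strict_mono_Suc_iff using qS gt by simp
    show "\<not> covers (q i) (q (Suc (Suc i)))" for i
      using nx(2)[of "q i" "q (Suc (Suc i))"] gt[of "q (Suc i)"] by (auto simp: qS)
  qed (auto simp: qS nx q_def)
qed

section \<open>Lacunary series that dominate all monomials\<close>

text \<open>The sum is split at the first chosen index \<open>I\<close> whose contact radius exceeds
  \<open>s\<close>. On either side the terms at least halve with each step away from the split,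
  starting from at most \<open>1 / u s\<close>, so each side contributes at most
  \<open>2 / u s\<close>.\<close>

lemma lacunary_sum_bound:
  assumes b: "strict_mono b" and nc: "\<And>i. \<not> covers (b i) (b (Suc i))"
    and s: "0 < s" "s < 1"
  shows "(\<Sum>j<J. m (b j) s) \<le> 4 / u s"
proof -
  have b_mono: "i \<le> j \<Longrightarrow> b i \<le> b j" for i j using b by (simp add: strict_mono_less_eq)
  have "\<exists>j. s < r (b j)"
  proof -
    obtain N where "s < r N" using r_exceeds[OF s(2)] by blast
    moreover have "r N \<le> r (b N)" using strict_mono_imp_increasing[OF b] by (intro r_mono)
    ultimately show ?thesis by (intro exI[of _ N]) simp
  qed
  define I where "I = (LEAST j. s < r (b j))"
  have I: "s < r (b I)" unfolding I_def by (rule LeastI_ex) fact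
  have less: "r (b j) \<le> s" if "j < I" for j using not_less_Least[of j "\<lambda>j. s < r (b j)"] that unfolding I_def by auto
  let ?w = "1 / u s"
  have w0: "0 < ?w" using u_pos[of s] s by simp
  \<comment> \<open>Indices are counted backwards from \<open>I - 1\<close>; the guard
    \<open>i < I\<close> keeps the natural subtraction exact.\<close>
  have left: "m (b (I - 1 - i)) s \<le> ?w * (1 / 2) ^ i" if "i < I" for i
    using that
  proof (induction i)
    case 0
    then show ?case using m_le[of s "b (I - 1)"] s by simp
  next
    case (Suc i)
    define j where "j = I - 1 - Suc i"
    have j: "Suc j = I - 1 - i" "Suc j < I" using Suc.prems by (auto simp: j_def)
    have "2 * m (b j) s \<le> m (b (Suc j)) s"
      using s less[OF j(2)] by (intro not_covers_decay(1)[OF b_mono nc]) auto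
    moreover have "m (b (Suc j)) s \<le> ?w * (1 / 2) ^ i" using Suc j(1) by simp
    ultimately have "m (b j) s \<le> ?w * (1 / 2) ^ Suc i" by simp
    then show ?case unfolding j_def .
  qed
  have right: "m (b (I + i)) s \<le> ?w * (1 / 2) ^ i" for i
  proof (induction i)
    case 0
    then show ?case using m_le[of s "b I"] s by simp
  next
    case (Suc i)
    have "s \<le> r (b (I + i))" using I r_mono[OF b_mono, of I "I + i"] by simp
    then have "2 * m (b (Suc (I + i))) s \<le> m (b (I + i)) s"
      using s by (intro not_covers_decay(2)[OF b_mono nc]) auto
    then show ?case using Suc by simp
  qed
  have geo: "(\<Sum>i<n. ?w * (1 / 2) ^ i) \<le> 2 * ?w" for n
  proof -
    have "(\<Sum>i<n. (1 / 2 :: real) ^ i) \<le> 2" by (simp add: sum_gp_strict)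
    then show ?thesis using w0 unfolding sum_distrib_left[symmetric] by (simp add: mult.commute mult_left_mono divide_right_mono)
  qed
  have "(\<Sum>j<J. m (b j) s) \<le> (\<Sum>j<I + J. m (b j) s)"
    using m_nonneg s by (intro sum_mono2) auto
  also have "\<dots> = (\<Sum>j<I. m (b j) s) + (\<Sum>i<J. m (b (I + i)) s)"
    by (induction J) auto
  also have "(\<Sum>j<I. m (b j) s) = (\<Sum>i<I. m (b (I - 1 - i)) s)"
    using sum.nat_diff_reindex[of "\<lambda>j. m (b j) s" I] by simp
  also have "(\<Sum>i<I. m (b (I - 1 - i)) s) \<le> (\<Sum>i<I. ?w * (1 / 2) ^ i)" using left by (intro sum_mono) auto
  also have "\<dots> \<le> 2 * ?w" by (rule geo)
  also have "(\<Sum>i<J. m (b (I + i)) s) \<le> (\<Sum>i<J. ?w * (1 / 2) ^ i)" using right by (intro sum_mono) auto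
  also have "\<dots> \<le> 2 * ?w" by (rule geo)
  finally show ?thesis by simp
qed

text \<open>The coefficients are positive, so on the radius the series dominates each of its terms,
  while on a circle its modulus is at most its value at the radius.\<close>

lemma lacunary_function:
  assumes b: "strict_mono b" and nc: "\<And>i. \<not> covers (b i) (b (Suc i))"
  obtains F where "F holomorphic_on ball 0 1"
    "\<And>z. norm z < 1 \<Longrightarrow> u (norm z) * norm (F z) \<le> 4 * u 0 / u (1 / 2)"
    "\<And>j t. 0 < t \<Longrightarrow> t < 1 \<Longrightarrow> m (b j) t \<le> norm (F (of_real t))"
proof -
  \<comment> \<open>The factor \<open>u 0 / u (1 / 2)\<close> lets one constant serve down to
    \<open>s = 0\<close>: for \<open>s \<le> 1 / 2\<close> the sum is compared with its value at
    1/2, and \<open>u s \<le> u 0\<close>.\<close>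
  have bound: "(\<Sum>j<J. m (b j) s) \<le> 4 * u 0 / u (1 / 2) / u s" if s: "0 \<le> s" "s < 1" for s J
  proof (cases "s \<le> 1 / 2")
    case True
    have "(\<Sum>j<J. m (b j) s) \<le> (\<Sum>j<J. m (b j) (1 / 2))"
      unfolding m_def using s True A_pos by (intro sum_mono mult_left_mono power_mono) (auto intro: less_imp_le)
    also have "\<dots> \<le> 4 / u (1 / 2)" by (rule lacunary_sum_bound[OF b nc]) auto
    also have "\<dots> \<le> 4 * u 0 / u (1 / 2) / u s"
      using u_pos[of "1/2"] u_pos[OF s] u_antimono[of 0 s] s by (simp add: field_simps)
    finally show ?thesis .
  next
    case False
    have "(\<Sum>j<J. m (b j) s) \<le> 4 / u s" using s False by (intro lacunary_sum_bound[OF b nc]) auto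
    also have "\<dots> \<le> 4 * u 0 / u (1 / 2) / u s"
      using u_pos[of "1/2"] u_pos[OF s] u_antimono[of 0 "1/2"] s by (simp add: field_simps)
    finally show ?thesis .
  qed
  have sm: "summable (\<lambda>j. m (b j) s)" and le: "(\<Sum>j. m (b j) s) \<le> 4 * u 0 / u (1 / 2) / u s"
    if s: "0 \<le> s" "s < 1" for s
  proof -
    show "summable (\<lambda>j. m (b j) s)"
      by (rule summableI_nonneg_bounded[OF m_nonneg[OF s(1)] bound[OF s]])
    then show "(\<Sum>j. m (b j) s) \<le> 4 * u 0 / u (1 / 2) / u s"
      by (rule suminf_le_const) (use bound[OF s] in auto)
  qed
  define F where "F z = (\<Sum>j. of_real (A (b j)) * z ^ b j)" for z :: complex
  \<comment> \<open>These are the coefficients of the same series written as an ordinary power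
    series, with zeros in the gaps; holomorphy is read off from this form.\<close>
  define c where "c n = (if n \<in> range b then of_real (A n) else 0 :: complex)" for n
  have nm: "norm (of_real (A n) * z ^ n) = m n (norm z)" for n and z :: complex
    using A_pos[of n] by (simp add: m_def norm_mult norm_power)
  have smz: "summable (\<lambda>j. norm (of_real (A (b j)) * z ^ b j))" if "norm z < 1" for z :: complex
    unfolding nm using sm that by simp
  show ?thesis
  proof (rule that[of F])
    have "(\<lambda>n. c n * z ^ n) sums F z" if z: "norm z < 1" for z
    proof -
      have "(\<lambda>j. c (b j) * z ^ b j) sums F z"
        using summable_sums[OF summable_norm_cancel[OF smz[OF z]]] by (simp add: c_def F_def)
      then show ?thesis
        by (subst (asm) sums_mono_reindex[OF b, of "\<lambda>n. c n * z ^ n"]) (auto simp: c_def)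
    qed
    then show "F holomorphic_on ball 0 1"
      by (intro power_series_holomorphic[of 0 1 c]) auto
    show "u (norm z) * norm (F z) \<le> 4 * u 0 / u (1 / 2)" if z: "norm z < 1" for z
    proof -
      have "norm (F z) \<le> (\<Sum>j. m (b j) (norm z))"
        using summable_norm[OF smz[OF z]] unfolding nm F_def .
      also have "\<dots> \<le> 4 * u 0 / u (1 / 2) / u (norm z)" using le z by simp
      finally show ?thesis using u_pos[of "norm z"] z unfolding mult.commute[of "u _"] by (subst (asm) pos_le_divide_eq) auto
    qed
    show "m (b j) t \<le> norm (F (of_real t))" if t: "0 < t" "t < 1" for j t
    proof -
      have "F (of_real t) = of_real (\<Sum>j. m (b j) t)"
        unfolding F_def using sm[of t] t by (subst suminf_of_real) (auto simp: m_def)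
      moreover have "m (b j) t \<le> (\<Sum>j. m (b j) t)"
        using sum_le_suminf[OF sm, of t "{j}"] t m_nonneg by simp
      ultimately show ?thesis by simp
    qed
  qed
qed

text \<open>Only indices two steps apart are known to be uncovered, so the greedy sequence is split
  into its even and odd members, each giving a lacunary function. Any \<open>k\<close> lies between
  two consecutive members, one of either parity, and these cover \<open>m k\<close> up to the factor
  2.\<close>

lemma two_majorants:
  obtains F G B where "F holomorphic_on ball 0 1" "G holomorphic_on ball 0 1"
    "\<And>z. norm z < 1 \<Longrightarrow> u (norm z) * norm (F z) \<le> B"
    "\<And>z. norm z < 1 \<Longrightarrow> u (norm z) * norm (G z) \<le> B"
    "\<And>k t. 0 < t \<Longrightarrow> t < 1 \<Longrightarrow> m k t \<le> 2 * (norm (F (of_real t)) + norm (G (of_real t)))"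
proof -
  obtain q where q: "strict_mono q" "q 0 = 0" "\<And>i. covers (q i) (q (Suc i))"
    "\<And>i. \<not> covers (q i) (q (Suc (Suc i)))" using greedy_indices by metis
  have ev: "strict_mono (\<lambda>i. q (2 * i))" and od: "strict_mono (\<lambda>i. q (Suc (2 * i)))"
    using q(1) by (auto simp: strict_mono_def)
  obtain F where F: "F holomorphic_on ball 0 1"
    "\<And>z. norm z < 1 \<Longrightarrow> u (norm z) * norm (F z) \<le> 4 * u 0 / u (1 / 2)"
    "\<And>j t. 0 < t \<Longrightarrow> t < 1 \<Longrightarrow> m (q (2 * j)) t \<le> norm (F (of_real t))"
    using lacunary_function[OF ev] q(4) by auto
  obtain G where G: "G holomorphic_on ball 0 1"
    "\<And>z. norm z < 1 \<Longrightarrow> u (norm z) * norm (G z) \<le> 4 * u 0 / u (1 / 2)"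
    "\<And>j t. 0 < t \<Longrightarrow> t < 1 \<Longrightarrow> m (q (Suc (2 * j))) t \<le> norm (G (of_real t))"
    using lacunary_function[OF od] q(4) by auto
  have qb: "m (q i) t \<le> norm (F (of_real t)) + norm (G (of_real t))" if t: "0 < t" "t < 1" for i t
  proof (cases "even i")
    case True
    then obtain j where "i = 2 * j" by blast
    then show ?thesis using F(3)[OF t, of j] by (simp add: add_increasing2)
  next
    case False
    then obtain j where "i = Suc (2 * j)" by (metis oddE Suc_eq_plus1)
    then show ?thesis using G(3)[OF t, of j] by (simp add: add_increasing)
  qed
  have "m k t \<le> 2 * (norm (F (of_real t)) + norm (G (of_real t)))" if t: "0 < t" "t < 1" for k t
  proof -
    have "\<exists>i. k < q i" using strict_mono_imp_increasing[OF q(1), of "Suc k"] by (intro exI[of _ "Suc k"]) simp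
    define I where "I = (LEAST i. k < q i)"
    have I: "k < q I" unfolding I_def by (rule LeastI_ex) fact
    then obtain i where i: "I = Suc i" using q(2) by (cases I) auto
    then have "q i \<le> k" using not_less_Least[of i "\<lambda>i. k < q i"] unfolding I_def by auto
    then have "m k t \<le> 2 * max (m (q i) t) (m (q (Suc i)) t)"
      using q(3)[of i] I i t unfolding covers_def by auto
    then show ?thesis using qb[OF t, of i] qb[OF t, of "Suc i"] by (simp add: max_def split: if_splits)
  qed
  then show ?thesis using that F G by blast
qed

end

section \<open>Existence of touching monomials and necessity for essential weights\<close>

text \<open>Because \<open>u\<close> tends to 0 at 1, the function \<open>t ^ n * u t\<close>
  extends continuously by 0 to the closed interval. Its maximum is positive, hence attained at some
  \<open>r < 1\<close>, and \<open>A\<close> is its reciprocal.\<close>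

lemma touching_monomials_exist:
  assumes u_pos: "\<And>t. 0 \<le> t \<Longrightarrow> t < 1 \<Longrightarrow> 0 < u t"
    and u_antimono: "\<And>s t. 0 \<le> s \<Longrightarrow> s \<le> t \<Longrightarrow> t < 1 \<Longrightarrow> u t \<le> u s"
    and u_lim: "(u \<longlongrightarrow> 0) (at_left (1::real))" and u_cont: "continuous_on {0..<1} u"
  obtains A r where "touching_monomials u A r"
proof -
  have "\<exists>A r. 0 < A \<and> 0 \<le> r \<and> r < 1 \<and> (\<forall>t. 0 \<le> t \<and> t < 1 \<longrightarrow> A * t ^ n * u t \<le> 1) \<and> A * r ^ n * u r = 1" for n
  proof -
    define p where "p t = (if t < 1 then t ^ n * u t else 0)" for t
    have "continuous_on {0..1} p"
      unfolding continuous_on_def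
    proof
      fix x :: real assume x: "x \<in> {0..1}"
      show "(p \<longlongrightarrow> p x) (at x within {0..1})"
      proof (cases "x < 1")
        case True
        have "continuous_on {0..<1} (\<lambda>t. t ^ n * u t)" by (intro continuous_intros u_cont)
        then have *: "((\<lambda>t. t ^ n * u t) \<longlongrightarrow> x ^ n * u x) (at x within {0..<1})"
          using x True unfolding continuous_on_def by auto
        have "at x within {0..1} = at x within {0..<1}"
          by (rule at_within_nhd[of _ "{..<1}"]) (use True in auto)
        moreover have "\<forall>\<^sub>F t in at x within {0..<1}. t ^ n * u t = p t"
          unfolding eventually_at_filter by (rule always_eventually) (auto simp: p_def)
        ultimately show ?thesis
          using * True by (simp add: p_def[of x] tendsto_cong)
      next
        case False
        with x have x1: "x = 1" by simp
        have "((\<lambda>t. t ^ n * u t) \<longlongrightarrow> 1 ^ n * 0) (at_left 1)" by (intro tendsto_intros u_lim)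
        moreover have "\<forall>\<^sub>F t in at_left (1::real). t ^ n * u t = p t"
          unfolding eventually_at_filter by (rule always_eventually) (auto simp: p_def)
        ultimately have "(p \<longlongrightarrow> 0) (at_left 1)" by (simp add: tendsto_cong)
        moreover have "at (1::real) within {0..1} \<le> at_left 1"
          unfolding at_within_def by (intro inf_mono) auto
        ultimately show ?thesis using x1 by (auto simp: p_def[of 1] intro: tendsto_mono)
      qed
    qed
    then obtain r where r: "r \<in> {0..1}" "\<And>t. t \<in> {0..1} \<Longrightarrow> p t \<le> p r"
      using continuous_attains_sup[of "{0..1::real}" p] by auto
    have "0 < p (1 / 2)" using u_pos[of "1 / 2"] by (simp add: p_def)
    also have "p (1 / 2) \<le> p r" by (rule r) auto
    finally have pos: "0 < p r" .
    then have r1: "r < 1" by (auto simp: p_def split: if_splits)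
    show ?thesis
    proof (intro exI conjI allI impI)
      show "0 < 1 / p r" using pos by simp
      show "1 / p r * t ^ n * u t \<le> 1" if "0 \<le> t \<and> t < 1" for t
        using r(2)[of t] that pos by (simp add: p_def[of t] mult_ac)
      show "1 / p r * r ^ n * u r = 1"
      proof -
        have "p r = r ^ n * u r" using r1 by (simp add: p_def)
        then show ?thesis using pos by (metis divide_self_if less_numeral_extra(3) mult.assoc mult_1 times_divide_eq_left)
      qed
    qed (use r r1 in auto)
  qed
  then obtain A r where "\<And>n. 0 < A n \<and> 0 \<le> r n \<and> r n < 1 \<and> (\<forall>t. 0 \<le> t \<and> t < 1 \<longrightarrow> A n * t ^ n * u t \<le> 1) \<and> A n * r n ^ n * u (r n) = 1"
    by metis
  then have "touching_monomials u A r"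
    by unfold_locales (use u_pos u_antimono u_lim in blast)+
  then show ?thesis by (rule that)
qed

text \<open>Being essential bounds \<open>1 / v\<close> by a multiple of the extremal modulus over
  the unit ball. On the radius this is at most a sum of two touching monomials up to
  \<open>1 / r 1\<close>, hence a multiple of the moduli of two fixed members of the space, whose
  integrability is part of well-definedness.\<close>

lemma essential_weight_integrable:
  assumes \<mu>: "borel_measure_01 \<mu>" and v: "weight v" and ess: "essential_weight v"
    and wd: "Imu_well_defined \<mu> (Hinf_v v)"
  shows "integrable \<mu> (\<lambda>t. 1 / v (complex_of_real t))"
proof -
  define u where "u t = v (complex_of_real t)" for t
  have radial: "v z = u (norm z)" if "norm z < 1" for z
  proof -
    have "z \<in> ball 0 1" using that by simp
    then show ?thesis using v unfolding weight_def u_def by blast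
  qed
  have u_cont: "continuous_on {0..<1} u"
    unfolding u_def
  proof (rule continuous_on_compose2[of "ball 0 1" v])
    show "continuous_on (ball 0 1) v" using v unfolding weight_def by blast
  qed (auto intro!: continuous_intros)
  obtain A r where "touching_monomials u A r"
  proof (rule touching_monomials_exist[of u])
    show "0 < u t" if "0 \<le> t" "t < 1" for t using weight_pos[OF v] that by (simp add: u_def)
    show "u t \<le> u s" if "0 \<le> s" "s \<le> t" "t < 1" for s t
    proof -
      have "complex_of_real s \<in> ball 0 1" "complex_of_real t \<in> ball 0 1" "norm (complex_of_real s) \<le> norm (complex_of_real t)"
        using that by auto
      then show ?thesis using v unfolding weight_def u_def by blast
    qed
    show "(u \<longlongrightarrow> 0) (at_left 1)" using v unfolding weight_def u_def by blast
  qed (use u_cont in auto)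
  then interpret touching_monomials u A r .
  obtain F G B where F: "F holomorphic_on ball 0 1" "\<And>z. norm z < 1 \<Longrightarrow> u (norm z) * norm (F z) \<le> B"
    and G: "G holomorphic_on ball 0 1" "\<And>z. norm z < 1 \<Longrightarrow> u (norm z) * norm (G z) \<le> B"
    and FG: "\<And>k t. 0 < t \<Longrightarrow> t < 1 \<Longrightarrow> m k t \<le> 2 * (norm (F (of_real t)) + norm (G (of_real t)))"
    using two_majorants by metis
  have "F \<in> Hinf_v v" "G \<in> Hinf_v v"
    using F G radial unfolding Hinf_v_def by (auto intro!: bdd_aboveI2[of _ _ B])
  \<comment> \<open>At \<open>z = 0\<close> the kernel is 1, so well-definedness says that
    \<open>F\<close> and \<open>G\<close> themselves are integrable on the radius.\<close>
  then have "integrable \<mu> (\<lambda>t. F (complex_of_real t) / (1 - complex_of_real t * 0))"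
      "integrable \<mu> (\<lambda>t. G (complex_of_real t) / (1 - complex_of_real t * 0))"
    using wd unfolding Imu_well_defined_def by (auto dest!: bspec[where x = "0::complex"])
  then have iFG: "integrable \<mu> (\<lambda>t. norm (F (complex_of_real t)))" "integrable \<mu> (\<lambda>t. norm (G (complex_of_real t)))"
    by (auto intro: integrable_norm)
  obtain c where c: "c > 0" "\<And>z. z \<in> ball 0 1 \<Longrightarrow> c / v z \<le> (SUP f\<in>{f\<in>Hinf_v v. Hinf_v_norm v f \<le> 1}. norm (f z))"
    using ess unfolding essential_weight_def by blast
  have r1: "0 < r 1" "r 1 < 1" using r_pos[of 1] r_less[of 1] by auto
  have zero: "(\<lambda>_. 0) \<in> {f\<in>Hinf_v v. Hinf_v_norm v f \<le> 1}"
    unfolding Hinf_v_def Hinf_v_norm_def by (simp add: bdd_aboveI2[of _ _ 0])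
  \<comment> \<open>The 4 comes from two monomials, each bounded by twice the sum of the moduli;
    \<open>r 1\<close> comes from the maximum principle and \<open>c\<close> from the weight being
    essential. The added constant takes care of \<open>t < r 1\<close> and is integrable since
    \<open>\<mu>\<close> is finite.\<close>
  have bound: "1 / u t \<le> 4 / (c * r 1) * (norm (F (of_real t)) + norm (G (of_real t))) + 1 / u (r 1)"
    if t: "t \<in> {0..<1}" for t
  proof (cases "r 1 \<le> t")
    case True
    have "c / v (of_real t) \<le> (SUP f\<in>{f\<in>Hinf_v v. Hinf_v_norm v f \<le> 1}. norm (f (of_real t)))"
      using t by (intro c) auto
    also have "\<dots> \<le> 4 / r 1 * (norm (F (of_real t)) + norm (G (of_real t)))"
    proof (rule cSUP_least)
      fix f assume "f \<in> {f\<in>Hinf_v v. Hinf_v_norm v f \<le> 1}"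
      then have f: "f \<in> Hinf_v v" "Hinf_v_norm v f \<le> 1" by auto
      have "norm (f z) * u (norm z) \<le> 1" if "norm z < 1" for z
        using Hinf_v_bound[OF f(1), of z] f(2) that radial[OF that] by (simp add: mult.commute)
      then obtain N where "norm (f (of_real t)) \<le> (m N t + m (Suc N) t) / r 1"
        using holomorphic_le_touching_monomials[of f t] True t f(1) unfolding Hinf_v_def by auto
      also have "\<dots> \<le> (4 * (norm (F (of_real t)) + norm (G (of_real t)))) / r 1"
        using FG[of t N] FG[of t "Suc N"] True t r1 by (intro divide_right_mono) auto
      finally show "norm (f (of_real t)) \<le> 4 / r 1 * (norm (F (of_real t)) + norm (G (of_real t)))" by simp
    qed (use zero in blast)
    finally have "(1 / c) * (c / u t) \<le> (1 / c) * (4 / r 1 * (norm (F (of_real t)) + norm (G (of_real t))))"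
      using c(1) unfolding u_def by (intro mult_left_mono) auto
    then have "1 / u t \<le> 4 / (c * r 1) * (norm (F (of_real t)) + norm (G (of_real t)))"
      using c(1) by simp
    moreover have "0 \<le> 1 / u (r 1)" using u_pos[of "r 1"] r1 by simp
    ultimately show ?thesis by linarith
  next
    case False
    then have "1 / u t \<le> 1 / u (r 1)"
      using t r1 u_antimono[of t "r 1"] u_pos[of "r 1"] by (intro frac_le) auto
    moreover have "0 \<le> 4 / (c * r 1) * (norm (F (of_real t)) + norm (G (of_real t)))" using c(1) r1 by simp
    ultimately show ?thesis by linarith
  qed
  interpret finite_measure \<mu> using \<mu> unfolding borel_measure_01_def by simp
  show ?thesis
    unfolding u_def[symmetric]
  proof (rule Bochner_Integration.integrable_bound[where f = "\<lambda>t. 4 / (c * r 1) * (norm (F (of_real t)) + norm (G (of_real t))) + 1 / u (r 1)"])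
    show "integrable \<mu> (\<lambda>t. 4 / (c * r 1) * (norm (F (of_real t)) + norm (G (of_real t))) + 1 / u (r 1))"
      using iFG by auto
    show "(\<lambda>t. 1 / u t) \<in> borel_measurable \<mu>"
      using u_pos by (intro borel_measurable_01_continuous[OF \<mu>] continuous_intros u_cont) (auto simp: less_imp_neq[symmetric])
    show "AE t in \<mu>. norm (1 / u t) \<le> norm (4 / (c * r 1) * (norm (F (of_real t)) + norm (G (of_real t))) + 1 / u (r 1))"
    proof (rule AE_I2)
      fix t assume "t \<in> space \<mu>"
      then have t: "t \<in> {0..<1}" using space_borel_measure_01[OF \<mu>] by simp
      then have "0 < u t" using u_pos by simp
      then show "norm (1 / u t) \<le> norm (4 / (c * r 1) * (norm (F (of_real t)) + norm (G (of_real t))) + 1 / u (r 1))"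
        using bound[OF t] by simp
    qed
  qed
qed

theorem theorem6:
  fixes \<mu> :: "real measure"
  assumes "borel_measure_01 \<mu>"
  shows "(\<forall>v. weight v \<and> integrable \<mu> (\<lambda>t. 1 / v (complex_of_real t))
              \<longrightarrow> Imu_good \<mu> (Hinf_v v) (Hinf_v_norm v))
       \<and> (\<forall>v. weight v \<and> essential_weight v \<and> Imu_well_defined \<mu> (Hinf_v v)
              \<longrightarrow> integrable \<mu> (\<lambda>t. 1 / v (complex_of_real t)))
       \<and> (carleson \<mu> \<longrightarrow> Imu_good \<mu> H1 H1_norm)"
proof (intro conjI allI impI)
  fix v assume "weight v \<and> integrable \<mu> (\<lambda>t. 1 / v (complex_of_real t))"
  then show "Imu_good \<mu> (Hinf_v v) (Hinf_v_norm v)"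
    using Imu_good_Hinf_v[OF assms] by blast
next
  fix v assume "weight v \<and> essential_weight v \<and> Imu_well_defined \<mu> (Hinf_v v)"
  then show "integrable \<mu> (\<lambda>t. 1 / v (complex_of_real t))"
    using essential_weight_integrable[OF assms] by blast
next
  assume "carleson \<mu>"
  then show "Imu_good \<mu> H1 H1_norm" by (rule Imu_good_H1[OF assms])
qed

end
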